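(* Let $k$ be a field and let $A$ be a Frobenius $k$-algebra with semisimple Nakayama automorphism $\mathfrak N$. Then the BV-operator $\Delta=Z_*\,\partial\,B_{\mathfrak N}^*\,\overline{\mathfrak C}$ on $H^\bullet(A,A_{\mathfrak N}^* )$ is $\Delta=\overline B_{\mathfrak N}$, where $\overline B_{\mathfrak N}:H^n(A,A_{\mathfrak N}^* )\to H^{n-1}(A,A_{\mathfrak N}^* )$ is given by $$\overline B_{\mathfrak N}([f])(a_1\otimes\cdots\otimes a_{n-1})(a_0)=\sum_{i=0}^{n-1}(-1)^{i(n-1)}f(a_i\otimes\cdots\otimes a_{n-1}\otimes a_0\otimes\mathfrak N(a_1)\otimes\cdots\otimes\mathfrak N(a_{i-1}))(1).$$
   Context: Conventions. $\otimes=\otimes_k$; algebras are associative and unital; $(-)^*=\mathrm{Hom}_k(-,k)$. For an $A$-bimodule $M$, $H^\bullet(A,M)$ (resp. $H_\bullet(A,M)$) is Hochschild cohomology (resp. homology), computed by the standard complexes $\mathrm{Hom}_k(A^{\otimes n},M)$ (resp. $M\otimes A^{\otimes n}$); $HH^\bullet(A)=H^\bullet(A,A)$. A Frobenius algebra is a finite-dimensional $k$-algebra $A$ with a non-degenerate associative ($\langle ab,c\rangle=\langle a,bc\rangle$) bilinear form $\langle-,-\rangle:A\times A\to k$. Its Nakayama automorphism is the algebra automorphism $\mathfrak N:A\to A$ with $\langle a,-\rangle=\langle-,\mathfrak N(a)\rangle$ for all $a\in A$. It is semisimple if it is diagonalizable over the algebraic closure of $k$. $A_{\mathfrak N}$ is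 the $A$-bimodule with underlying space $A$ and actions $axb=a\,x\,\mathfrak N(b)$ (products in $A$ on the right-hand side). $A_{\mathfrak N}^*$ has the bimodule structure $(afb)(c)=f(bc\,\mathfrak N(a))$. The map $Z:A\to A_{\mathfrak N}^*$, $Z(a)=\langle a,-\rangle$, is an isomorphism of $A$-bimodules, and $Z_*:HH^\bullet(A)\to H^\bullet(A,A_{\mathfrak N}^* )$ is the isomorphism induced by composition with $Z$. Operators. $B_{\mathfrak N}:H_\bullet(A,A_{\mathfrak N})\to H_{\bullet+1}(A,A_{\mathfrak N})$ sends $[a_0\otimes a_1\otimes\cdots\otimes a_n]$ to $$\Big[\sum_{i=0}^n(-1)^{in}\,1\otimes a_i\otimes\cdots\otimes a_n\otimes a_0\otimes\mathfrak N(a_1)\otimes\cdots\otimes\mathfrak N(a_{i-1})\Big],$$ and $B_{\mathfrak N}^*$ is its $k$-dual. $\partial:H_\bullet(A,A_{\mathfrak N})^*\to HH^\bullet(A)$ is the isomorphism with inverse $\partial^{-1}([f])=(-1)^{|f|}\langle-,f\rangle$, i.e. $\partial^{-1}([f])([a_0\otimes\cdots\otimes a_n])=(-1)^n\langle a_0,f(a_1\otimes\cdots\otimes a_n)\rangle$. $\overline{\mathfrak C}:H^n(A,A_{\mathfrak N}^* )\to H_n(A,A_{\mathfrak N})^*$ is the isomorphism $\overline{\mathfrak C}([f])([x\otimes a_1\otimes\cdots\otimes a_n])=(-1)^nf(a_1\otimes\cdots\otimes a_n)(x)$.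
   Formalization: The dual of B_N is taken with a minus sign (else Δ = −B̄_N); ∂^{-1} uses ⟨f(a_1⊗…⊗a_n),a_0⟩, as ⟨a_0,f⟩ is ill-defined on classes; the i=0 word is a_0⊗N(a_1)⊗…; the B_N and B̄_N formulas are applied to N-invariant representatives. *)

theory Defs
  imports
    "Jordan_Normal_Form.Matrix"
    "HOL-Algebra.Algebraic_Closure_Type"
    "HOL-Library.Poly_Mapping"
    "HOL-Library.Function_Algebras"
begin

section \<open>Classes modulo a subspace\<close>

definition cls :: "'v::ab_group_add set \<Rightarrow> 'v \<Rightarrow> 'v set" where
  "cls V x = {y. y - x \<in> V}"

text \<open>
  A map on a quotient that is given by a formula \<open>g\<close> on representatives is written
  \<open>the_elem (g ` \<alpha>)\<close>: it is the common value of \<open>g\<close> on the (admissible) representatives in the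
  class \<open>\<alpha>\<close>.
\<close>


section \<open>Hochschild cohomology\<close>

text \<open>
  A bimodule is given by its carrier \<open>M\<close>, scalar multiplication \<open>sm\<close>, left action \<open>l\<close> and right
  action \<open>r\<close>.  Linear maps from the \<open>n\<close>-th tensor power of the algebra are represented by
  multilinear functions of lists of length \<open>n\<close>, extended by 0 to lists of other lengths.
\<close>

definition merge :: "nat \<Rightarrow> 'a::times list \<Rightarrow> 'a list" where
  "merge i as = take i as @ [as ! i * as ! Suc i] @ drop (i + 2) as"

definition cochains ::
  "('k \<Rightarrow> 'a \<Rightarrow> 'a) \<Rightarrow> 'm set \<Rightarrow> ('k \<Rightarrow> 'm \<Rightarrow> 'm) \<Rightarrow> nat \<Rightarrow> ('a::ring list \<Rightarrow> 'm::ab_group_add) set"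
  where
  "cochains s M sm n = {f.
     (\<forall>as. f as \<in> M) \<and>
     (\<forall>as. length as \<noteq> n \<longrightarrow> f as = 0) \<and>
     (\<forall>as i x y. length as = n \<and> i < n \<longrightarrow> f (as[i := x + y]) = f (as[i := x]) + f (as[i := y])) \<and>
     (\<forall>as i c x. length as = n \<and> i < n \<longrightarrow> f (as[i := s c x]) = sm c (f (as[i := x])))}"

definition coboundary_map ::
  "('k::field \<Rightarrow> 'm \<Rightarrow> 'm) \<Rightarrow> ('a \<Rightarrow> 'm \<Rightarrow> 'm) \<Rightarrow> ('m \<Rightarrow> 'a \<Rightarrow> 'm) \<Rightarrow> nat \<Rightarrow>
   ('a::ring list \<Rightarrow> 'm::ab_group_add) \<Rightarrow> 'a list \<Rightarrow> 'm" where
  "coboundary_map sm l r n f = (\<lambda>as. if length as = Suc n then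
       l (hd as) (f (tl as))
       + (\<Sum>i<n. sm ((-1) ^ Suc i) (f (merge i as)))
       + sm ((-1) ^ Suc n) (r (f (butlast as)) (last as))
     else 0)"

definition cocycles where
  "cocycles s M sm l r n = {f \<in> cochains s M sm n. coboundary_map sm l r n f = 0}"

definition coboundaries where
  "coboundaries s M sm l r n =
     (case n of 0 \<Rightarrow> {0} | Suc m \<Rightarrow> coboundary_map sm l r m ` cochains s M sm m)"

definition cohomology where
  "cohomology s M sm l r n = cls (coboundaries s M sm l r n) ` cocycles s M sm l r n"


section \<open>Hochschild homology\<close>

text \<open>
  The space of \<open>n\<close>-chains, i.e. the tensor product of the bimodule with the \<open>n\<close>-th tensor power of
  the algebra, is the free vector space on the pairs \<open>(m, [a\<^sub>1, \<dots>, a\<^sub>n])\<close> modulo the subspace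
  \<open>tensor_rel\<close> spanned by the multilinearity relations.  Chains are handled through
  representatives in the free space: a cycle is a representative whose boundary lies in the
  relations, and the relations are added to the boundaries.
\<close>

definition fscale :: "'k::field \<Rightarrow> ('b \<Rightarrow>\<^sub>0 'k) \<Rightarrow> ('b \<Rightarrow>\<^sub>0 'k)" where
  "fscale c p = Poly_Mapping.map ((*) c) p"

abbreviation gen :: "'b \<Rightarrow> ('b \<Rightarrow>\<^sub>0 'k::field)" where
  "gen x \<equiv> Poly_Mapping.single x 1"

definition lin_ext :: "('b \<Rightarrow> ('c \<Rightarrow>\<^sub>0 'k)) \<Rightarrow> ('b \<Rightarrow>\<^sub>0 'k::field) \<Rightarrow> ('c \<Rightarrow>\<^sub>0 'k)" where
  "lin_ext g p = (\<Sum>x\<in>Poly_Mapping.keys p. fscale (Poly_Mapping.lookup p x) (g x))"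

definition free_chains :: "nat \<Rightarrow> ('m \<times> 'a list \<Rightarrow>\<^sub>0 'k::field) set" where
  "free_chains n = {p. \<forall>(m, as) \<in> Poly_Mapping.keys p. length as = n}"

definition tensor_rel ::
  "('k::field \<Rightarrow> 'a \<Rightarrow> 'a) \<Rightarrow> ('k \<Rightarrow> 'm \<Rightarrow> 'm) \<Rightarrow> nat \<Rightarrow> ('m::ab_group_add \<times> 'a::ring list \<Rightarrow>\<^sub>0 'k) set"
  where
  "tensor_rel s sm n = Modules.module.span fscale
    ({gen (m + m', as) - gen (m, as) - gen (m', as) | m m' as. length as = n} \<union>
     {gen (sm c m, as) - fscale c (gen (m, as)) | c m as. length as = n} \<union>
     {gen (m, as[i := x + y]) - gen (m, as[i := x]) - gen (m, as[i := y])
        | m as i x y. length as = n \<and> i < n} \<union>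
     {gen (m, as[i := s c x]) - fscale c (gen (m, as[i := x]))
        | c m as i x. length as = n \<and> i < n})"

definition boundary_map ::
  "('a \<Rightarrow> 'm \<Rightarrow> 'm) \<Rightarrow> ('m \<Rightarrow> 'a \<Rightarrow> 'm) \<Rightarrow> nat \<Rightarrow>
   ('m \<times> 'a::ring list \<Rightarrow>\<^sub>0 'k::field) \<Rightarrow> ('m \<times> 'a list \<Rightarrow>\<^sub>0 'k)" where
  "boundary_map l r n p = (if n = 0 then 0 else
     lin_ext (\<lambda>(m, as).
       gen (r m (hd as), tl as)
       + (\<Sum>i<n - 1. fscale ((-1) ^ Suc i) (gen (m, merge i as)))
       + fscale ((-1) ^ n) (gen (l (last as) m, butlast as))) p)"

definition cycles where
  "cycles s sm l r n = {p \<in> free_chains n. boundary_map l r n p \<in> tensor_rel s sm (n - 1)}"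

definition boundaries where
  "boundaries s sm l r n =
     {boundary_map l r (Suc n) p + q | p q. p \<in> free_chains (Suc n) \<and> q \<in> tensor_rel s sm n}"

definition homology where
  "homology s sm l r n = cls (boundaries s sm l r n) ` cycles s sm l r n"


section \<open>Frobenius algebras\<close>

text \<open>
  The sort of the type of \<open>A\<close> is that of unital associative rings in which \<open>0 = 1\<close> is permitted.
\<close>

locale frobenius_algebra = vector_space scale
  for scale :: "'k::field \<Rightarrow> 'a::{ring, monoid_mult} \<Rightarrow> 'a" (infixr \<open>*s\<close> 75) +
  fixes form :: "'a \<Rightarrow> 'a \<Rightarrow> 'k"
  assumes scale_mult_left: "(c *s a) * b = c *s (a * b)"
    and scale_mult_right: "a * (c *s b) = c *s (a * b)"
    and finite_dim: "\<exists>B. finite B \<and> span B = UNIV"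
    and form_add_left: "form (a + a') b = form a b + form a' b"
    and form_add_right: "form a (b + b') = form a b + form a b'"
    and form_scale_left: "form (c *s a) b = c * form a b"
    and form_scale_right: "form a (c *s b) = c * form a b"
    and form_assoc: "form (a * b) c' = form a (b * c')"
    and nondegenerate_left: "(\<forall>b. form a b = 0) \<Longrightarrow> a = 0"
    and nondegenerate_right: "(\<forall>a. form a b = 0) \<Longrightarrow> b = 0"
begin

definition nakayama :: "'a \<Rightarrow> 'a" where
  "nakayama a = (THE b. \<forall>x. form a x = form x b)"

text \<open>
  Column \<open>j\<close> of the matrix holds the coordinates of the image of the \<open>j\<close>-th basis vector.
\<close>

definition nakayama_matrix :: "'a list \<Rightarrow> 'k mat" where
  "nakayama_matrix bs = mat (length bs) (length bs)
     (\<lambda>(i, j). representation (set bs) (nakayama (bs ! j)) (bs ! i))"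

definition nakayama_semisimple :: bool where
  "nakayama_semisimple \<longleftrightarrow>
     (\<exists>bs. distinct bs \<and> independent (set bs) \<and> span (set bs) = UNIV \<and>
       (\<exists>D :: 'k alg_closure mat. diagonal_mat D \<and> similar_mat (map_mat to_ac (nakayama_matrix bs)) D))"


subsection \<open>The bimodules and their (co)homology\<close>

text \<open>The suffixes are \<open>A\<close> for the regular bimodule, \<open>N\<close> for the twisted bimodule, and \<open>Nd\<close> for
  its dual.\<close>

definition actl_N :: "'a \<Rightarrow> 'a \<Rightarrow> 'a" where
  "actl_N a x = a * x"

definition actr_N :: "'a \<Rightarrow> 'a \<Rightarrow> 'a" where
  "actr_N x b = x * nakayama b"

definition carrier_Nd :: "('a \<Rightarrow> 'k) set" where
  "carrier_Nd = {\<phi>. (\<forall>x y. \<phi> (x + y) = \<phi> x + \<phi> y) \<and> (\<forall>c x. \<phi> (c *s x) = c * \<phi> x)}"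

definition scale_Nd :: "'k \<Rightarrow> ('a \<Rightarrow> 'k) \<Rightarrow> 'a \<Rightarrow> 'k" where
  "scale_Nd c \<phi> = (\<lambda>x. c * \<phi> x)"

definition actl_Nd :: "'a \<Rightarrow> ('a \<Rightarrow> 'k) \<Rightarrow> 'a \<Rightarrow> 'k" where
  "actl_Nd a \<phi> = (\<lambda>c. \<phi> (c * nakayama a))"

definition actr_Nd :: "('a \<Rightarrow> 'k) \<Rightarrow> 'a \<Rightarrow> 'a \<Rightarrow> 'k" where
  "actr_Nd \<phi> b = (\<lambda>c. \<phi> (b * c))"

abbreviation "HH_A \<equiv> cohomology scale UNIV scale (*) (*)"

abbreviation "cocycles_Nd \<equiv> cocycles scale carrier_Nd scale_Nd actl_Nd actr_Nd"
abbreviation "coboundaries_Nd \<equiv> coboundaries scale carrier_Nd scale_Nd actl_Nd actr_Nd"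
abbreviation "H_Nd \<equiv> cohomology scale carrier_Nd scale_Nd actl_Nd actr_Nd"

abbreviation "tensor_rel_N \<equiv> tensor_rel scale scale"
abbreviation "cycles_N \<equiv> cycles scale scale actl_N actr_N"
abbreviation "boundaries_N \<equiv> boundaries scale scale actl_N actr_N"
abbreviation "H_N \<equiv> homology scale scale actl_N actr_N"


subsection \<open>The operators\<close>

text \<open>
  For \<open>as = [a\<^sub>1, \<dots>, a\<^sub>n]\<close> this is the word
  \<open>a\<^sub>i \<otimes> \<dots> \<otimes> a\<^sub>n \<otimes> a\<^sub>0 \<otimes> N(a\<^sub>1) \<otimes> \<dots> \<otimes> N(a\<^sub>i\<^sub>-\<^sub>1)\<close> with \<open>n + 1\<close> letters.  Indices are read
  cyclically, so for \<open>i = 0\<close> the word starts with \<open>a\<^sub>0\<close> and all other letters are twisted (this is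
  the word for \<open>i = n + 1\<close>).  The untwisted word \<open>a\<^sub>0 \<otimes> a\<^sub>1 \<otimes> \<dots> \<otimes> a\<^sub>n\<close> would not give an operator
  compatible with the differentials.
\<close>

definition twisted_word :: "nat \<Rightarrow> 'a \<Rightarrow> 'a list \<Rightarrow> 'a list" where
  "twisted_word i a0 as =
     (if i = 0 then a0 # map nakayama as
      else drop (i - 1) as @ [a0] @ map nakayama (take (i - 1) as))"

text \<open>
  On chains, \<open>b B + B b = T - 1\<close>, where \<open>T\<close> applies the Nakayama automorphism to all
  tensor factors.  The formulas for the operators therefore define (co)homology classes on
  \<open>T\<close>-invariant representatives, which exist in every class if the Nakayama automorphism is
  semisimple.
\<close>

definition invariant_chain :: "nat \<Rightarrow> ('a \<times> 'a list \<Rightarrow>\<^sub>0 'k) \<Rightarrow> bool" where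
  "invariant_chain n p \<longleftrightarrow>
     lin_ext (\<lambda>(x, as). gen (nakayama x, map nakayama as)) p - p \<in> tensor_rel_N n"

definition invariant_cochain :: "('a list \<Rightarrow> 'a \<Rightarrow> 'k) \<Rightarrow> bool" where
  "invariant_cochain f \<longleftrightarrow> (\<forall>as x. f (map nakayama as) (nakayama x) = f as x)"

definition B_chain :: "nat \<Rightarrow> ('a \<times> 'a list \<Rightarrow>\<^sub>0 'k) \<Rightarrow> ('a \<times> 'a list \<Rightarrow>\<^sub>0 'k)" where
  "B_chain n = lin_ext (\<lambda>(a0, as). \<Sum>i\<le>n. fscale ((-1) ^ (i * n)) (gen (1, twisted_word i a0 as)))"

definition B_N :: "nat \<Rightarrow> ('a \<times> 'a list \<Rightarrow>\<^sub>0 'k) set \<Rightarrow> ('a \<times> 'a list \<Rightarrow>\<^sub>0 'k) set" where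
  "B_N n \<xi> = the_elem ((\<lambda>p. cls (boundaries_N (Suc n)) (B_chain n p)) ` {p \<in> \<xi>. invariant_chain n p})"

text \<open>
  The dual of an operator \<open>D\<close> of degree \<open>1\<close> or \<open>-1\<close> is \<open>\<Phi> \<mapsto> - \<Phi> \<circ> D\<close>.  This is the convention
  for which the signs \<open>(-1)\<^sup>n\<close> in \<open>Cbar\<close> and \<open>partial_inv\<close> below make these maps commute with the
  Hochschild differential of cochains and the dual of the differential of chains.  Functionals
  on homology are extended by 0 to arguments that are not homology classes.
\<close>

definition B_N_dual ::
  "nat \<Rightarrow> (('a \<times> 'a list \<Rightarrow>\<^sub>0 'k) set \<Rightarrow> 'k) \<Rightarrow> ('a \<times> 'a list \<Rightarrow>\<^sub>0 'k) set \<Rightarrow> 'k" where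
  "B_N_dual n \<Phi> = (\<lambda>\<xi>. if \<xi> \<in> H_N n then - \<Phi> (B_N n \<xi>) else 0)"

definition eval_chain :: "('a list \<Rightarrow> 'a \<Rightarrow> 'k) \<Rightarrow> ('a \<times> 'a list \<Rightarrow>\<^sub>0 'k) \<Rightarrow> 'k" where
  "eval_chain f p = (\<Sum>(x, as)\<in>Poly_Mapping.keys p. Poly_Mapping.lookup p (x, as) * f as x)"

definition Cbar ::
  "nat \<Rightarrow> ('a list \<Rightarrow> 'a \<Rightarrow> 'k) set \<Rightarrow> ('a \<times> 'a list \<Rightarrow>\<^sub>0 'k) set \<Rightarrow> 'k" where
  "Cbar n \<alpha> = (\<lambda>\<xi>. if \<xi> \<in> H_N n
     then the_elem {(-1) ^ n * eval_chain f p | f p. f \<in> \<alpha> \<and> p \<in> \<xi>} else 0)"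

definition Z_map :: "'a \<Rightarrow> 'a \<Rightarrow> 'k" where
  "Z_map a = (\<lambda>x. form a x)"

definition Z_star :: "nat \<Rightarrow> ('a list \<Rightarrow> 'a) set \<Rightarrow> ('a list \<Rightarrow> 'a \<Rightarrow> 'k) set" where
  "Z_star n \<alpha> = the_elem ((\<lambda>f. cls (coboundaries_Nd n) (\<lambda>as. Z_map (f as))) ` \<alpha>)"

text \<open>
  Here \<open>\<langle>-, f\<rangle>\<close> is the pairing of the twisted bimodule with its dual, the values of \<open>f\<close> being
  regarded as functionals through \<open>Z\<close>; so \<open>a\<^sub>0 \<otimes> a\<^sub>1 \<otimes> \<dots> \<otimes> a\<^sub>n\<close> is sent to
  \<open>(-1)\<^sup>n Z(f(a\<^sub>1, \<dots>, a\<^sub>n))(a\<^sub>0)\<close>.  If the Nakayama automorphism is not the identity, using the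
  value \<open>form a\<^sub>0 (f(a\<^sub>1, \<dots>, a\<^sub>n))\<close> of the Frobenius form instead does not vanish on boundaries in
  general.
\<close>

definition partial_inv ::
  "nat \<Rightarrow> ('a list \<Rightarrow> 'a) set \<Rightarrow> ('a \<times> 'a list \<Rightarrow>\<^sub>0 'k) set \<Rightarrow> 'k" where
  "partial_inv n \<alpha> = (\<lambda>\<xi>. if \<xi> \<in> H_N n
     then the_elem {(-1) ^ n * eval_chain (\<lambda>as. Z_map (f as)) p | f p. f \<in> \<alpha> \<and> p \<in> \<xi>} else 0)"

definition partial ::
  "nat \<Rightarrow> (('a \<times> 'a list \<Rightarrow>\<^sub>0 'k) set \<Rightarrow> 'k) \<Rightarrow> ('a list \<Rightarrow> 'a) set" where
  "partial n = the_inv_into (HH_A n) (partial_inv n)"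

text \<open>Both operators below go from degree \<open>n + 1\<close> to degree \<open>n\<close>.\<close>

definition BV_Delta :: "nat \<Rightarrow> ('a list \<Rightarrow> 'a \<Rightarrow> 'k) set \<Rightarrow> ('a list \<Rightarrow> 'a \<Rightarrow> 'k) set" where
  "BV_Delta n \<alpha> = Z_star n (partial n (B_N_dual n (Cbar (Suc n) \<alpha>)))"

definition Bbar_cochain :: "nat \<Rightarrow> ('a list \<Rightarrow> 'a \<Rightarrow> 'k) \<Rightarrow> 'a list \<Rightarrow> 'a \<Rightarrow> 'k" where
  "Bbar_cochain n f = (\<lambda>as. if length as = n
     then (\<lambda>a0. \<Sum>i\<le>n. (-1) ^ (i * n) * f (twisted_word i a0 as) 1) else 0)"

definition Bbar :: "nat \<Rightarrow> ('a list \<Rightarrow> 'a \<Rightarrow> 'k) set \<Rightarrow> ('a list \<Rightarrow> 'a \<Rightarrow> 'k) set" where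
  "Bbar n \<alpha> = the_elem
     ((\<lambda>f. cls (coboundaries_Nd n) (Bbar_cochain n f)) ` {f \<in> \<alpha>. invariant_cochain f})"

end

end

theory Submission
  imports Defs "HOL-Library.Product_Plus"
begin

text \<open>
  Evaluating a cochain with values in \<open>A\<^sub>N\<^sup>*\<close> on a chain with coefficients in \<open>A\<^sub>N\<close> makes the cochain
  complex the linear dual of the chain complex: the differential \<open>\<delta>\<close> is the transpose of the
  boundary \<open>b\<close>, and the operator \<open>Bbar\<close> is the transpose of the twisted Connes operator \<open>B\<close>.
  So for a cocycle \<open>f\<close> and a cycle \<open>p\<close> on which everything is defined, both sides of the claim
  come from the one number \<open>f (B p) = (Bbar f) p\<close>.  The sign \<open>(-1)\<^sup>n\<^sup>+\<^sup>1\<close> of \<open>Cbar\<close>, the sign in the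
  dual of \<open>B\<close> and the sign \<open>(-1)\<^sup>n\<close> of \<open>partial_inv\<close> cancel (\<open>BV_Delta_cls\<close>).  Over a field a cocycle
  that vanishes on all cycles is a coboundary (\<open>in_coboundaries_if_vanishes_on_cycles\<close>), so these
  numbers determine the class; the same fact makes \<open>partial_inv\<close> injective.

  The work lies in showing that the formulas for \<open>B\<close> and \<open>Bbar\<close> describe maps on classes.  Let \<open>T\<close>
  be the action of the Nakayama automorphism on all tensor factors.  Transposed to cochains, the
  Connes homotopy reads \<open>T\<^sup>* - 1 = Bbar \<delta> + \<delta> Bbar\<close> (\<open>Bbar_homotopy\<close>).  Hence \<open>Bbar\<close> and \<open>B\<close> preserve
  cocycles and cycles among the \<open>T\<close>-invariant elements, and \<open>T\<close> acts trivially on classes.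

  Invariant representatives exist because there is a polynomial \<open>r\<close> over \<open>k\<close> with \<open>r(1) = 1\<close> such
  that \<open>(X - 1) r(X)\<close> kills \<open>T\<^sup>*\<close> (\<open>invariant_average\<close>): then \<open>r(T)\<close> has invariant values and does not
  change classes.  To find \<open>r\<close>, note that over the algebraic closure \<open>T\<^sup>*\<close> is diagonalizable, with
  products of eigenvalues of the Nakayama automorphism as eigenvalues.  These finitely many
  numbers are algebraic over \<open>k\<close>; multiply polynomials over \<open>k\<close> that vanish at them and divide by the
  largest possible power of \<open>X - 1\<close>.  Semisimplicity is what makes a single factor \<open>X - 1\<close> enough
  to kill the part belonging to the eigenvalue 1.
\<close>

section \<open>Linear functionals on free vector spaces\<close>

lemma lookup_fscale [simp]: "Poly_Mapping.lookup (fscale c p) x = c * Poly_Mapping.lookup p x"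
  by (simp add: fscale_def Poly_Mapping.map.rep_eq when_def)

interpretation free: vector_space "fscale :: 'k::field \<Rightarrow> ('b \<Rightarrow>\<^sub>0 'k) \<Rightarrow> ('b \<Rightarrow>\<^sub>0 'k)"
  by unfold_locales (auto intro!: poly_mapping_eqI simp: lookup_add algebra_simps)

definition pairing :: "('b \<Rightarrow> 'k::field) \<Rightarrow> ('b \<Rightarrow>\<^sub>0 'k) \<Rightarrow> 'k" where
  "pairing \<phi> p = (\<Sum>x\<in>Poly_Mapping.keys p. Poly_Mapping.lookup p x * \<phi> x)"

lemma pairing_superset:
  assumes "finite S" "Poly_Mapping.keys p \<subseteq> S"
  shows "pairing \<phi> p = (\<Sum>x\<in>S. Poly_Mapping.lookup p x * \<phi> x)"
  unfolding pairing_def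
  by (rule sum.mono_neutral_left) (use assms in \<open>auto simp: in_keys_iff\<close>)

lemma pairing_add: "pairing \<phi> (p + q) = pairing \<phi> p + pairing \<phi> q"
proof -
  let ?S = "Poly_Mapping.keys p \<union> Poly_Mapping.keys q"
  have "Poly_Mapping.keys (p + q) \<subseteq> ?S" by (rule keys_add)
  then show ?thesis
    by (subst (1 2 3) pairing_superset[where S = ?S])
       (auto simp: lookup_add algebra_simps sum.distrib)
qed

lemma pairing_fscale: "pairing \<phi> (fscale c p) = c * pairing \<phi> p"
proof -
  have "Poly_Mapping.keys (fscale c p) \<subseteq> Poly_Mapping.keys p"
    by (auto simp: in_keys_iff)
  then show ?thesis
    by (subst (1 2) pairing_superset[where S = "Poly_Mapping.keys p"])
       (auto simp: sum_distrib_left mult.assoc)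
qed

lemma pairing_zero [simp]: "pairing \<phi> 0 = 0"
  by (simp add: pairing_def)

lemma pairing_gen [simp]: "pairing \<phi> (gen x) = \<phi> x"
  by (simp add: pairing_def)

lemma pairing_uminus: "pairing \<phi> (- p) = - pairing \<phi> p"
  using pairing_add[of \<phi> p "- p"] by (simp add: eq_neg_iff_add_eq_0 add.commute)

lemma pairing_diff: "pairing \<phi> (p - q) = pairing \<phi> p - pairing \<phi> q"
  using pairing_add[of \<phi> p "- q"] by (simp add: pairing_uminus)

lemma pairing_sum: "pairing \<phi> (\<Sum>i\<in>I. p i) = (\<Sum>i\<in>I. pairing \<phi> (p i))"
  by (induction I rule: infinite_finite_induct) (auto simp: pairing_add)

lemma pairing_lin_ext: "pairing \<phi> (lin_ext g p) = pairing (\<lambda>x. pairing \<phi> (g x)) p"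
  by (simp add: lin_ext_def pairing_sum pairing_fscale) (simp add: pairing_def)

lemma pairing_cong:
  "(\<And>x. x \<in> Poly_Mapping.keys p \<Longrightarrow> \<phi> x = \<psi> x) \<Longrightarrow> pairing \<phi> p = pairing \<psi> p"
  by (simp add: pairing_def)

lemma lin_ext_gen: "lin_ext gen p = p"
proof (rule poly_mapping_eqI)
  fix x
  have "Poly_Mapping.lookup (lin_ext gen p) x
      = (\<Sum>y\<in>Poly_Mapping.keys p. if y = x then Poly_Mapping.lookup p y else 0)"
    unfolding lin_ext_def lookup_sum
    by (intro sum.cong) (auto simp: lookup_single when_def)
  also have "\<dots> = Poly_Mapping.lookup p x"
    by (simp add: in_keys_iff)
  finally show "Poly_Mapping.lookup (lin_ext gen p) x = Poly_Mapping.lookup p x" .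
qed

lemma linear_functional_eq_pairing:
  fixes h :: "('b \<Rightarrow>\<^sub>0 'k::field) \<Rightarrow> 'k"
  assumes "\<And>p q. h (p + q) = h p + h q" "\<And>c p. h (fscale c p) = c * h p"
  shows "h p = pairing (\<lambda>x. h (gen x)) p"
proof -
  have h0: "h 0 = 0" using assms(1)[of 0 0] by (simp only: add_0 add_cancel_right_right)
  have "h (\<Sum>i\<in>I. q i) = (\<Sum>i\<in>I. h (q i))" for I :: "'b set" and q
    by (induction I rule: infinite_finite_induct) (auto simp: assms h0)
  then have "h (lin_ext gen p) = pairing (\<lambda>x. h (gen x)) p"
    by (simp add: lin_ext_def pairing_def assms)
  then show ?thesis by (simp add: lin_ext_gen)
qed

lemma lin_ext_superset:
  assumes "finite S" "Poly_Mapping.keys p \<subseteq> S"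
  shows "lin_ext g p = (\<Sum>x\<in>S. fscale (Poly_Mapping.lookup p x) (g x))"
  unfolding lin_ext_def
  by (rule sum.mono_neutral_left) (use assms in \<open>auto simp: in_keys_iff\<close>)

lemma lin_ext_add: "lin_ext g (p + q) = lin_ext g p + lin_ext g q"
proof -
  let ?S = "Poly_Mapping.keys p \<union> Poly_Mapping.keys q"
  have "Poly_Mapping.keys (p + q) \<subseteq> ?S" by (rule keys_add)
  then show ?thesis
    by (subst (1 2 3) lin_ext_superset[where S = ?S])
       (auto simp: lookup_add free.scale_left_distrib sum.distrib)
qed

lemma lin_ext_fscale: "lin_ext g (fscale c p) = fscale c (lin_ext g p)"
proof -
  have "Poly_Mapping.keys (fscale c p) \<subseteq> Poly_Mapping.keys p"
    by (auto simp: in_keys_iff)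
  then show ?thesis
    by (subst (1 2) lin_ext_superset[where S = "Poly_Mapping.keys p"])
       (auto simp: free.scale_sum_right)
qed

text \<open>
  On the subspace spanned by \<open>b U\<close> and \<open>W\<close> the functional \<open>h\<close> is prescribed, and \<open>ker\<close> says that the
  prescription is consistent.  Instead of first descending to quotients and then extending, one
  works in the product of the target space with the field: the graph of the prescription is a
  subspace that does not contain \<open>(0, 1)\<close>, so some functional \<open>\<phi>\<close> vanishes on the graph and is 1 at
  \<open>(0, 1)\<close>, and \<open>h v = - \<phi> (v, 0)\<close> is the extension.
\<close>

lemma functional_extension:
  fixes s\<^sub>1 :: "'k::field \<Rightarrow> 'u::ab_group_add \<Rightarrow> 'u" and s\<^sub>2 :: "'k \<Rightarrow> 'v::ab_group_add \<Rightarrow> 'v"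
    and f :: "'u \<Rightarrow> 'k"
  assumes s: "vector_space s\<^sub>1" "vector_space s\<^sub>2"
    and b: "\<And>x y. b (x + y) = b x + b y" "\<And>c x. b (s\<^sub>1 c x) = s\<^sub>2 c (b x)"
    and f: "\<And>x y. f (x + y) = f x + f y" "\<And>c x. f (s\<^sub>1 c x) = c * f x"
    and U: "module.subspace s\<^sub>1 U" and W: "module.subspace s\<^sub>2 W"
    and ker: "\<And>u. u \<in> U \<Longrightarrow> b u \<in> W \<Longrightarrow> f u = 0"
  obtains h where "\<And>x y. h (x + y) = h x + h y" "\<And>c x. h (s\<^sub>2 c x) = c * h x"
    "\<And>w. w \<in> W \<Longrightarrow> h w = 0" "\<And>u. u \<in> U \<Longrightarrow> h (b u) = f u"
proof -
  interpret V1: vector_space s\<^sub>1 by fact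
  interpret V2: vector_space s\<^sub>2 by fact
  define s where "s = (\<lambda>c (v, t). (s\<^sub>2 c v, c * t :: 'k))"
  interpret P: vector_space s
    by unfold_locales (auto simp: s_def algebra_simps V2.scale_right_distrib V2.scale_left_distrib)
  interpret K: vector_space "(*) :: 'k \<Rightarrow> 'k \<Rightarrow> 'k"
    by unfold_locales (auto simp: algebra_simps)
  interpret PK: vector_space_pair s "(*) :: 'k \<Rightarrow> 'k \<Rightarrow> 'k" ..
  define G where "G = {(b u + w, f u) | u w. u \<in> U \<and> w \<in> W}"
  have f0: "f 0 = 0" and b0: "b 0 = 0"
    using f(1)[of 0 0] b(1)[of 0 0] by (simp_all only: add_0 add_cancel_right_right)
  have G: "P.subspace G"
  proof (rule P.subspaceI)
    show "0 \<in> G"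
      using V1.subspace_0[OF U] V2.subspace_0[OF W] f0 b0
      by (force simp: G_def zero_prod_def)
    show "x + y \<in> G" if xy: "x \<in> G" "y \<in> G" for x y
    proof -
      obtain u w u' w' where *: "x = (b u + w, f u)" "u \<in> U" "w \<in> W"
        "y = (b u' + w', f u')" "u' \<in> U" "w' \<in> W"
        using xy unfolding G_def by blast
      have "x + y = (b (u + u') + (w + w'), f (u + u'))"
        by (simp add: * b f algebra_simps)
      then show ?thesis
        using V1.subspace_add[OF U] V2.subspace_add[OF W] * unfolding G_def by blast
    qed
    show "s c x \<in> G" if x: "x \<in> G" for c x
    proof -
      obtain u w where *: "x = (b u + w, f u)" "u \<in> U" "w \<in> W"
        using x unfolding G_def by blast
      have "s c x = (b (s\<^sub>1 c u) + s\<^sub>2 c w, f (s\<^sub>1 c u))"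
        by (simp add: * b f s_def V2.scale_right_distrib)
      then show ?thesis
        using V1.subspace_scale[OF U] V2.subspace_scale[OF W] * unfolding G_def by blast
    qed
  qed
  have notin: "(0, 1) \<notin> G"
  proof
    assume "(0, 1) \<in> G"
    then obtain u w where *: "b u + w = 0" "f u = 1" "u \<in> U" "w \<in> W"
      unfolding G_def by auto
    have "b u = - w" using *(1) by (simp add: eq_neg_iff_add_eq_0)
    then have "b u \<in> W" using V2.subspace_neg[OF W *(4)] by simp
    then show False using ker * by simp
  qed
  obtain B where B: "B \<subseteq> G" "P.independent B" "G \<subseteq> P.span B"
    using P.maximal_independent_subset_extend[of "{}" G] P.independent_empty by auto
  have "P.span B \<subseteq> G" using B G by (intro P.span_minimal)
  then have "P.independent (insert (0, 1) B)"
    using notin B by (intro P.independent_insertI) auto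
  then obtain \<phi> where \<phi>: "Vector_Spaces.linear s (*) \<phi>"
    "\<forall>x\<in>insert (0, 1) B. \<phi> x = (if x = (0, 1) then 1 else 0)"
    using PK.linear_independent_extend[of "insert (0, 1) B" "\<lambda>x. if x = (0, 1) then 1 else 0"]
    by blast
  interpret \<phi>: Vector_Spaces.linear s "(*)" \<phi> by fact
  have zero: "\<phi> x = 0" if "x \<in> G" for x
  proof -
    have "x \<in> P.span B" using that B by auto
    moreover have "\<And>x. x \<in> B \<Longrightarrow> \<phi> x = 0" using \<phi>(2) B notin by auto
    ultimately show ?thesis
      using PK.linear_eq_0_on_span[OF \<phi>(1)] by blast
  qed
  have one: "\<phi> (0, t) = t" for t
    using \<phi>.scale[of t "(0, 1)"] \<phi>(2) by (simp add: s_def)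
  show ?thesis
  proof (rule that[of "\<lambda>v. - \<phi> (v, 0)"])
    show "- \<phi> (x + y, 0) = - \<phi> (x, 0) + - \<phi> (y, 0)" for x y
      using \<phi>.add[of "(x, 0)" "(y, 0)"] by simp
    show "- \<phi> (s\<^sub>2 c x, 0) = c * - \<phi> (x, 0)" for c x
      using \<phi>.scale[of c "(x, 0)"] by (simp add: s_def)
    show "- \<phi> (w, 0) = 0" if "w \<in> W" for w
    proof -
      have "(b 0 + w, f 0) \<in> G" using that V1.subspace_0[OF U] unfolding G_def by blast
      then show ?thesis using zero by (simp add: b0 f0)
    qed
    show "- \<phi> (b u, 0) = f u" if "u \<in> U" for u
    proof -
      have "(b u + 0, f u) \<in> G" using that V2.subspace_0[OF W] unfolding G_def by blast
      then have "\<phi> ((b u, 0) + (0, f u)) = 0" using zero by simp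
      then have "\<phi> (b u, 0) + \<phi> (0, f u) = 0" by (simp only: \<phi>.add)
      then show ?thesis unfolding one by (simp add: neg_eq_iff_add_eq_0)
    qed
  qed
qed

section \<open>Classes modulo a subgroup\<close>

definition subgroup_add :: "'v::ab_group_add set \<Rightarrow> bool" where
  "subgroup_add V \<longleftrightarrow> 0 \<in> V \<and> (\<forall>x\<in>V. \<forall>y\<in>V. x - y \<in> V)"

lemma cls_self: "subgroup_add V \<Longrightarrow> x \<in> cls V x"
  by (simp add: cls_def subgroup_add_def)

lemma cls_eq_iff:
  assumes "subgroup_add V"
  shows "cls V x = cls V y \<longleftrightarrow> x - y \<in> V"
proof
  assume "cls V x = cls V y"
  then show "x - y \<in> V" using cls_self[OF assms, of x] by (auto simp: cls_def)
next
  assume xy: "x - y \<in> V"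
  have "z - y \<in> V \<longleftrightarrow> z - x \<in> V" for z
  proof
    assume "z - y \<in> V"
    then have "(z - y) - (x - y) \<in> V" using assms xy unfolding subgroup_add_def by blast
    then show "z - x \<in> V" by simp
  next
    assume zx: "z - x \<in> V"
    have "0 - (x - y) \<in> V" using assms xy unfolding subgroup_add_def by blast
    then have "(z - x) - (0 - (x - y)) \<in> V" using assms zx unfolding subgroup_add_def by blast
    then show "z - y \<in> V" by simp
  qed
  then show "cls V x = cls V y" by (auto simp: cls_def)
qed

lemma the_elem_image_const:
  assumes "S \<noteq> {}" "\<And>x. x \<in> S \<Longrightarrow> g x = c"
  shows "the_elem (g ` S) = c"
proof -
  have "g ` S = {c}" using assms by auto
  then show ?thesis by simp
qed

section \<open>Multilinear functions of lists\<close>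

text \<open>
  Scalars act on the values through \<open>\<sigma>\<close>, which is the identity for values in the ground field and
  the embedding for values in its algebraic closure.
\<close>

definition multilin ::
  "('k \<Rightarrow> 'a \<Rightarrow> 'a) \<Rightarrow> ('k \<Rightarrow> 'b) \<Rightarrow> nat \<Rightarrow> ('a::plus list \<Rightarrow> 'b::comm_ring) \<Rightarrow> bool" where
  "multilin s \<sigma> n F \<longleftrightarrow> (\<forall>ys i. length ys = n \<longrightarrow> i < n \<longrightarrow>
     (\<forall>x y. F (ys[i := x + y]) = F (ys[i := x]) + F (ys[i := y])) \<and>
     (\<forall>c x. F (ys[i := s c x]) = \<sigma> c * F (ys[i := x])))"

lemma multilin_sum:
  assumes "\<And>i. i \<in> I \<Longrightarrow> multilin s \<sigma> n (F i)"
  shows "multilin s \<sigma> n (\<lambda>ys. \<Sum>i\<in>I. c i * F i ys)"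
  using assms
  by (auto simp: multilin_def algebra_simps sum_distrib_left sum.distrib intro!: sum.cong)

lemma multilin_diff:
  assumes "multilin s \<sigma> n F" "multilin s \<sigma> n G"
  shows "multilin s \<sigma> n (\<lambda>ys. F ys - G ys)"
  using assms by (auto simp: multilin_def algebra_simps)

lemma multilin_cong:
  assumes "\<And>ys. length ys = n \<Longrightarrow> F ys = G ys"
  shows "multilin s \<sigma> n F = multilin s \<sigma> n G"
  using assms by (simp add: multilin_def)

definition linear_endo :: "('k \<Rightarrow> 'a \<Rightarrow> 'a) \<Rightarrow> ('a::plus \<Rightarrow> 'a) \<Rightarrow> bool" where
  "linear_endo s L \<longleftrightarrow> (\<forall>x y. L (x + y) = L x + L y) \<and> (\<forall>c x. L (s c x) = s c (L x))"

text \<open>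
  Maps of words in which every input letter enters exactly one output letter, and does so
  linearly.  Precomposing with such a map preserves multilinearity
  (\<open>multilin_comp_slotwise\<close>).  The faces of the Hochschild complex, the rotations of the Connes
  operator and the action of the Nakayama automorphism are all of this kind, so this one notion
  shows that the corresponding operators send cochains to cochains.
\<close>

definition slotwise ::
  "('k \<Rightarrow> 'a \<Rightarrow> 'a) \<Rightarrow> nat \<Rightarrow> nat \<Rightarrow> ('a::plus list \<Rightarrow> 'a list) \<Rightarrow> bool" where
  "slotwise s n m \<theta> \<longleftrightarrow> (\<forall>ys. length ys = n \<longrightarrow> length (\<theta> ys) = m \<and>
     (\<forall>i<n. \<exists>j<m. \<exists>zs L. length zs = m \<and> linear_endo s L \<and> (\<forall>z. \<theta> (ys[i := z]) = zs[j := L z])))"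

lemma slotwiseI:
  assumes "\<And>ys. length ys = n \<Longrightarrow> length (\<theta> ys) = m"
    "\<And>ys i. length ys = n \<Longrightarrow> i < n \<Longrightarrow> \<exists>j<m. \<exists>zs L. length zs = m \<and>
       linear_endo s L \<and> (\<forall>z. \<theta> (ys[i := z]) = zs[j := L z])"
  shows "slotwise s n m \<theta>"
  using assms by (auto simp: slotwise_def)

lemma multilin_comp_slotwise:
  fixes \<theta> :: "'a::plus list \<Rightarrow> 'a list"
  assumes F: "multilin s \<sigma> m F" and \<theta>: "slotwise s n m \<theta>"
  shows "multilin s \<sigma> n (\<lambda>ys. F (\<theta> ys))"
  unfolding multilin_def
proof (intro allI impI)
  fix ys :: "'a list" and i
  assume ys: "length ys = n" "i < n"
  obtain j zs L where *: "j < m" "length zs = m" "linear_endo s L"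
    "\<And>z. \<theta> (ys[i := z]) = zs[j := L z]"
    using \<theta> ys unfolding slotwise_def by blast
  show "(\<forall>x y. F (\<theta> (ys[i := x + y])) = F (\<theta> (ys[i := x])) + F (\<theta> (ys[i := y]))) \<and>
     (\<forall>c x. F (\<theta> (ys[i := s c x])) = \<sigma> c * F (\<theta> (ys[i := x])))"
    using F * unfolding multilin_def by (simp add: linear_endo_def)
qed

lemma slotwise_comp:
  fixes \<theta> :: "'a::plus list \<Rightarrow> 'a list"
  assumes \<theta>: "slotwise s n m \<theta>" and \<eta>: "slotwise s m p \<eta>"
  shows "slotwise s n p (\<lambda>ys. \<eta> (\<theta> ys))"
proof (rule slotwiseI)
  show "length (\<eta> (\<theta> ys)) = p" if "length ys = n" for ys
    using that \<theta> \<eta> by (simp add: slotwise_def)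
next
  fix ys :: "'a list" and i
  assume ys: "length ys = n" "i < n"
  obtain j zs L where 1: "j < m" "length zs = m" "linear_endo s L"
    "\<And>z. \<theta> (ys[i := z]) = zs[j := L z]"
    using \<theta> ys unfolding slotwise_def by blast
  obtain k ws L' where 2: "k < p" "length ws = p" "linear_endo s L'"
    "\<And>z. \<eta> (zs[j := z]) = ws[k := L' z]"
    using \<eta> 1(1,2) unfolding slotwise_def by blast
  have "linear_endo s (\<lambda>z. L' (L z))"
    using 1(3) 2(3) by (simp add: linear_endo_def)
  then show "\<exists>j<p. \<exists>zs L. length zs = p \<and> linear_endo s L \<and>
      (\<forall>z. \<eta> (\<theta> (ys[i := z])) = zs[j := L z])"
    using 1 2 by (intro exI[of _ k] conjI exI[of _ ws] exI[of _ "\<lambda>z. L' (L z)"]) simp_all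
qed

lemma slotwise_Cons:
  fixes c :: "'a::plus"
  shows "slotwise s n (Suc n) (Cons c)"
proof (rule slotwiseI)
  fix ys :: "'a list" and i
  assume ys: "length ys = n" "i < n"
  show "\<exists>j<Suc n. \<exists>zs L. length zs = Suc n \<and> linear_endo s L \<and>
      (\<forall>z. c # ys[i := z] = zs[j := L z])"
    using ys by (intro exI[of _ "Suc i"] conjI exI[of _ "c # ys"] exI[of _ "\<lambda>z. z"])
      (simp_all add: linear_endo_def)
qed simp

lemma slotwise_permute:
  fixes \<theta> :: "'a::plus list \<Rightarrow> 'a list"
  assumes len: "\<And>ys. length ys = n \<Longrightarrow> length (\<theta> ys) = n"
    and nth: "\<And>ys p. length ys = n \<Longrightarrow> p < n \<Longrightarrow> \<theta> ys ! p = L p (ys ! \<pi> p)"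
    and \<pi>: "bij_betw \<pi> {..<n} {..<n}"
    and L: "\<And>p. linear_endo s (L p)"
  shows "slotwise s n n \<theta>"
proof (rule slotwiseI)
  fix ys :: "'a list" and i
  assume ys: "length ys = n" "i < n"
  obtain p where p: "p < n" "\<pi> p = i"
    using \<pi> ys(2) unfolding bij_betw_def by (metis image_iff lessThan_iff)
  have "\<theta> (ys[i := z]) = (\<theta> ys)[p := L p z]" for z
  proof (rule nth_equalityI)
    show "length (\<theta> (ys[i := z])) = length ((\<theta> ys)[p := L p z])"
      using ys by (simp add: len)
    fix q assume "q < length (\<theta> (ys[i := z]))"
    then have q: "q < n" using ys by (simp add: len)
    have "\<pi> q = i \<longleftrightarrow> q = p"
      using \<pi> p q unfolding bij_betw_def inj_on_def by auto
    moreover have "\<pi> q < n" using \<pi> q unfolding bij_betw_def by auto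
    ultimately show "\<theta> (ys[i := z]) ! q = (\<theta> ys)[p := L p z] ! q"
      using ys q p by (cases "q = p") (auto simp: nth len)
  qed
  then show "\<exists>j<n. \<exists>zs L. length zs = n \<and> linear_endo s L \<and>
      (\<forall>z. \<theta> (ys[i := z]) = zs[j := L z])"
    using p ys len L by blast
qed (rule len)

lemma slotwise_map:
  assumes "linear_endo s L"
  shows "slotwise s n n (map L)"
  by (rule slotwise_permute[where L = "\<lambda>_. L" and \<pi> = id]) (use assms in auto)

section \<open>Multiplying adjacent letters\<close>

lemma length_merge [simp]: "Suc i < length as \<Longrightarrow> length (merge i as) = length as - 1"
  by (simp add: merge_def)

lemma nth_merge:
  assumes "Suc i < length as" "j < length as - 1"
  shows "merge i as ! j =
    (if j < i then as ! j else if j = i then as ! i * as ! Suc i else as ! Suc j)"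
  using assms by (auto simp: merge_def nth_append nth_Cons' min_def)

lemma merge_append1: "Suc i < length u \<Longrightarrow> merge i (u @ v) = merge i u @ v"
  by (simp add: merge_def nth_append)

lemma merge_append2: "merge (length u + i) (u @ v) = u @ merge i v"
  by (simp add: merge_def nth_append)

lemma merge_Cons_Suc [simp]: "merge (Suc i) (x # as) = x # merge i as"
  by (simp add: merge_def)

lemma merge_Cons_0 [simp]: "merge 0 (x # y # as) = x * y # as"
  by (simp add: merge_def)

lemma map_merge:
  assumes "\<And>x y. g (x * y) = g x * g y" "Suc i < length as"
  shows "map g (merge i as) = merge i (map g as)"
  using assms by (simp add: merge_def take_map drop_map)

lemma merge_merge:
  fixes as :: "'a::semigroup_mult list"
  assumes "d < e" "Suc e < length as"
  shows "merge d (merge e as) = merge (e - 1) (merge d as)"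
  using assms
  by (intro nth_equalityI) (auto simp: nth_merge mult.assoc)

lemma merge_take_drop:
  "Suc i < length as \<Longrightarrow> d \<le> i \<Longrightarrow> drop d (merge i as) = merge (i - d) (drop d as)"
  using merge_append2[of "take d as" "i - d" "drop d as"] by simp

lemma butlast_merge: "Suc (Suc i) < length as \<Longrightarrow> butlast (merge i as) = merge i (butlast as)"
proof -
  assume *: "Suc (Suc i) < length as"
  then have "as \<noteq> []" by auto
  then have "merge i as = merge i (butlast as) @ [last as]"
    using * merge_append1[of i "butlast as" "[last as]"] by simp
  then show ?thesis by simp
qed

lemma last_merge: "Suc (Suc i) < length as \<Longrightarrow> last (merge i as) = last as"
  using merge_append1[of i "butlast as" "[last as]"] 
  by (metis append_butlast_last_id last_snoc length_butlast less_diff_conv list.size(3) not_less_zero add.commute plus_1_eq_Suc)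

lemma sum_fun_apply: "(\<Sum>i\<in>I. f i) x = (\<Sum>i\<in>I. f i x)"
  by (induction I rule: infinite_finite_induct) auto

section \<open>Evaluating polynomials at algebraic elements\<close>

definition eval_ac :: "'k::field poly \<Rightarrow> 'k alg_closure \<Rightarrow> 'k alg_closure" where
  "eval_ac p z = poly (map_poly to_ac p) z"

lemma eval_ac_add: "eval_ac (p + q) z = eval_ac p z + eval_ac q z"
proof -
  have "map_poly to_ac (p + q) = map_poly to_ac p + map_poly to_ac q"
    by (intro poly_eqI) (simp add: coeff_map_poly)
  then show ?thesis by (simp add: eval_ac_def)
qed

lemma eval_ac_pCons: "eval_ac (pCons a p) z = to_ac a + z * eval_ac p z"
  by (simp add: eval_ac_def map_poly_pCons)

lemma eval_ac_smult: "eval_ac (smult c p) z = to_ac c * eval_ac p z"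
  by (simp add: eval_ac_def map_poly_smult)

lemma eval_ac_0 [simp]: "eval_ac 0 z = 0"
  by (simp add: eval_ac_def)

lemma eval_ac_1 [simp]: "eval_ac 1 z = 1"
  by (simp add: eval_ac_def)

lemma eval_ac_mult: "eval_ac (p * q) z = eval_ac p z * eval_ac q z"
  by (induction p) (simp_all add: eval_ac_add eval_ac_smult eval_ac_pCons algebra_simps)

lemma eval_ac_prod: "eval_ac (\<Prod>i\<in>I. p i) z = (\<Prod>i\<in>I. eval_ac (p i) z)"
  by (induction I rule: infinite_finite_induct) (simp_all add: eval_ac_mult)

lemma eval_ac_power: "eval_ac (p ^ n) z = eval_ac p z ^ n"
  by (induction n) (simp_all add: eval_ac_mult)

lemma eval_ac_altdef:
  assumes "degree p \<le> N"
  shows "eval_ac p z = (\<Sum>i\<le>N. to_ac (coeff p i) * z ^ i)"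
proof -
  have "eval_ac p z = (\<Sum>i\<le>degree p. to_ac (coeff p i) * z ^ i)"
    by (simp add: eval_ac_def poly_altdef coeff_map_poly degree_map_poly)
  also have "\<dots> = (\<Sum>i\<le>N. to_ac (coeff p i) * z ^ i)"
    using assms by (intro sum.mono_neutral_left) (auto simp: coeff_eq_0)
  finally show ?thesis .
qed

text \<open>
  Multiply annihilating polynomials of the elements of \<open>S\<close> and remove the factor \<open>X - 1\<close> as often as
  possible.  The quotient \<open>r\<close> does not vanish at 1 and can be normalized there; it vanishes at
  all elements of \<open>S\<close> other than 1, which is the second property.
\<close>

lemma separating_polynomial:
  fixes S :: "'k::field alg_closure set"
  assumes "finite S"
  obtains r :: "'k poly" where "poly r 1 = 1" "\<And>z. z \<in> S \<Longrightarrow> z * eval_ac r z = eval_ac r z"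
proof -
  have "\<exists>p. p \<noteq> 0 \<and> eval_ac p z = 0" for z :: "'k alg_closure"
    using alg_closure_algebraic[of z] unfolding eval_ac_def by blast
  then obtain p :: "'k alg_closure \<Rightarrow> 'k poly" where p: "\<And>z. p z \<noteq> 0" "\<And>z. eval_ac (p z) z = 0"
    by metis
  define q where "q = (\<Prod>z\<in>S. p z)"
  have "q \<noteq> 0" using assms p by (simp add: q_def)
  then obtain r where r: "q = [:-1, 1:] ^ order 1 q * r" "\<not> [:-1, 1:] dvd r"
    using order_decomp[of q 1] by auto
  have r1: "poly r 1 \<noteq> 0" using r(2) by (simp add: poly_eq_0_iff_dvd)
  have root: "z * eval_ac r z = eval_ac r z" if "z \<in> S" for z
  proof -
    have "eval_ac q z = 0" using that assms p by (auto simp: q_def eval_ac_prod)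
    then have "eval_ac ([:-1, 1:] ^ order 1 q) z * eval_ac r z = 0"
      by (subst (asm) r(1)) (simp only: eval_ac_mult)
    then have "z = 1 \<or> eval_ac r z = 0"
      by (auto simp: eval_ac_power eval_ac_pCons)
    then show ?thesis by auto
  qed
  show ?thesis
  proof (rule that[of "smult (1 / poly r 1) r"])
    show "poly (smult (1 / poly r 1) r) 1 = 1" using r1 by simp
    show "z * eval_ac (smult (1 / poly r 1) r) z = eval_ac (smult (1 / poly r 1) r) z" if "z \<in> S" for z
      using root[OF that] by (simp add: eval_ac_smult)
  qed
qed

context frobenius_algebra begin

section \<open>The Nakayama automorphism\<close>

lemma slotwise_merge:
  assumes "Suc d < n"
  shows "slotwise scale n (n - 1) (merge d)"
proof (rule slotwiseI)
  fix ys :: "'a list" and i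
  assume ys: "length ys = n" "i < n"
  define j where "j = (if i \<le> d then i else i - 1)"
  define L where "L = (\<lambda>z. if i = d then z * ys ! Suc d else if i = Suc d then ys ! d * z else z)"
  have "merge d (ys[i := z]) = (merge d ys)[j := L z]" for z
    using assms ys
    by (intro nth_equalityI) (auto simp: nth_merge nth_list_update j_def L_def)
  moreover have "linear_endo scale L"
    by (auto simp: linear_endo_def L_def algebra_simps scale_mult_left scale_mult_right)
  moreover have "j < n - 1" "length (merge d ys) = n - 1"
    using assms ys by (auto simp: j_def)
  ultimately show "\<exists>j<n - 1. \<exists>zs L. length zs = n - 1 \<and> linear_endo scale L \<and>
      (\<forall>z. merge d (ys[i := z]) = zs[j := L z])"
    by blast
qed (use assms in simp)

text \<open>
  For a basis \<open>B\<close>, the map \<open>a \<mapsto> (\<Sum>b\<in>B. \<beta> a b *s b)\<close> is an injective endomorphism of a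
  finite-dimensional space, hence surjective; so the values of \<open>\<beta> a\<close> on \<open>B\<close> can be prescribed.  This is
  used for the Frobenius form in both orders of its arguments, to obtain the Nakayama automorphism
  and the surjectivity of \<open>Z\<close>.
\<close>

lemma functional_represented:
  fixes \<beta> :: "'a \<Rightarrow> 'a \<Rightarrow> 'k"
  assumes left: "\<And>a b c. \<beta> (a + b) c = \<beta> a c + \<beta> b c" "\<And>t a c. \<beta> (t *s a) c = t * \<beta> a c"
    and right: "\<And>a b c. \<beta> a (b + c) = \<beta> a b + \<beta> a c" "\<And>t a c. \<beta> a (t *s c) = t * \<beta> a c"
    and nondeg: "\<And>a. (\<forall>b. \<beta> a b = 0) \<Longrightarrow> a = 0"
    and \<phi>: "\<phi> \<in> carrier_Nd"
  shows "\<exists>a. \<beta> a = \<phi>"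
proof -
  obtain B0 where B0: "finite B0" "span B0 = UNIV" using finite_dim by blast
  obtain B where B: "B \<subseteq> B0" "independent B" "B0 \<subseteq> span B"
    using maximal_independent_subset_extend[of "{}" B0] independent_empty by auto
  have span_B: "span B = UNIV"
    using B0(2) B(3) span_mono[of B0 "span B"] span_span by auto
  have fin: "finite B" using B(1) B0(1) finite_subset by blast
  interpret fd: finite_dimensional_vector_space scale B
    by unfold_locales (use B fin span_B in auto)
  have ext: "\<psi> = \<psi>'"
    if "\<psi> \<in> carrier_Nd" "\<psi>' \<in> carrier_Nd" "\<And>b. b \<in> B \<Longrightarrow> \<psi> b = \<psi>' b" for \<psi> \<psi>'
  proof
    fix x
    have 0: "\<chi> 0 = 0" if "\<chi> \<in> carrier_Nd" for \<chi>
      using that scale_zero_left[of 0] unfolding carrier_Nd_def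
      by (metis (mono_tags, lifting) mem_Collect_eq mult_zero_left)
    have "x \<in> span B" using span_B by simp
    then show "\<psi> x = \<psi>' x"
      by (induction rule: span_induct_alt)
        (use that 0[OF that(1)] 0[OF that(2)] in \<open>auto simp: carrier_Nd_def\<close>)
  qed
  define L where "L a = (\<Sum>b\<in>B. \<beta> a b *s b)" for a
  have L_add: "L (x + y) = L x + L y" for x y
    by (simp add: L_def left scale_left_distrib sum.distrib)
  have L_scale: "L (c *s x) = c *s L x" for c x
    by (simp add: L_def left scale_sum_right)
  have lin: "Vector_Spaces.linear scale scale L"
    by unfold_locales (simp_all add: L_add L_scale)
  have \<beta>_carrier: "\<beta> a \<in> carrier_Nd" for a
    by (simp add: carrier_Nd_def right)
  have zero_carrier: "(\<lambda>_. 0) \<in> carrier_Nd" by (simp add: carrier_Nd_def)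
  have ker: "a = 0" if "L a = 0" for a
  proof -
    have "\<beta> a b = 0" if b: "b \<in> B" for b
      using independentD[OF B(2) fin subset_refl, of "\<beta> a" b] \<open>L a = 0\<close> b by (simp add: L_def)
    then have "\<beta> a = (\<lambda>_. 0)" by (intro ext \<beta>_carrier zero_carrier) auto
    then show ?thesis using nondeg by simp
  qed
  have "inj L"
  proof (rule injI)
    fix x y assume xy: "L x = L y"
    have "L x = L (x - y) + L y" using L_add[of "x - y" y] by simp
    then have "L (x - y) = 0" using xy by simp
    then show "x = y" using ker by fastforce
  qed
  then have "surj L" using fd.linear_inj_imp_surj[OF lin] by simp
  then obtain a where a: "L a = (\<Sum>b\<in>B. \<phi> b *s b)" by (metis surjD)
  have "\<beta> a b = \<phi> b" if b: "b \<in> B" for b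
  proof -
    have "(\<Sum>b\<in>B. (\<beta> a b - \<phi> b) *s b) = 0"
      using a by (simp add: L_def scale_left_diff_distrib sum_subtractf)
    then show ?thesis
      using independentD[OF B(2) fin subset_refl, of "\<lambda>b. \<beta> a b - \<phi> b" b] b by simp
  qed
  then have "\<beta> a = \<phi>" by (intro ext \<beta>_carrier \<phi>) auto
  then show ?thesis by blast
qed

lemma form_zero_diff:
  "form (a - a') b = form a b - form a' b" "form a (b - b') = form a b - form a b'"
  using form_add_left[of "a - a'" a' b] form_add_right[of a "b - b'" b']
  by (simp_all only: diff_add_cancel eq_diff_eq)

lemma form_right_cancel: "(\<And>x. form x a = form x b) \<Longrightarrow> a = b"
  using nondegenerate_right[of "a - b"] by (simp add: form_zero_diff)

lemma form_left_cancel: "(\<And>x. form a x = form b x) \<Longrightarrow> a = b"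
  using nondegenerate_left[of "a - b"] by (simp add: form_zero_diff)

lemma form_nakayama: "form a x = form x (nakayama a)"
proof -
  have "\<exists>b. (\<lambda>x. form x b) = form a"
    using functional_represented[of "\<lambda>b x. form x b" "form a"]
    by (simp add: form_add_left form_add_right form_scale_left form_scale_right
        nondegenerate_right carrier_Nd_def)
  then obtain b where b: "\<forall>x. form a x = form x b" by metis
  have "\<forall>x. form a x = form x (nakayama a)"
    unfolding nakayama_def by (rule theI[of _ b]) (use b form_right_cancel in auto)
  then show ?thesis by simp
qed

lemma nakayama_add: "nakayama (a + b) = nakayama a + nakayama b"
  by (rule form_right_cancel) (simp add: form_add_right form_add_left flip: form_nakayama)

lemma nakayama_scale: "nakayama (c *s a) = c *s nakayama a"
  by (rule form_right_cancel) (simp add: form_scale_right form_scale_left flip: form_nakayama)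

lemma nakayama_mult: "nakayama (a * b) = nakayama a * nakayama b"
proof (rule form_right_cancel)
  fix x
  have "form x (nakayama (a * b)) = form b (x * nakayama a)"
    by (metis form_assoc form_nakayama)
  then show "form x (nakayama (a * b)) = form x (nakayama a * nakayama b)"
    by (metis form_assoc form_nakayama)
qed

lemma linear_endo_nakayama: "linear_endo scale nakayama"
  by (simp add: linear_endo_def nakayama_add nakayama_scale)

lemma Z_map_surj: "\<phi> \<in> carrier_Nd \<Longrightarrow> \<exists>a. Z_map a = \<phi>"
  using functional_represented[of form \<phi>] nondegenerate_left
  by (simp add: Z_map_def form_add_left form_add_right form_scale_left form_scale_right)

lemma Z_map_inj: "Z_map a = Z_map b \<Longrightarrow> a = b"
  unfolding Z_map_def by (rule form_left_cancel) (simp add: fun_eq_iff)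

section \<open>Face maps\<close>

text \<open>
  A generator \<open>a\<^sub>0 \<otimes> a\<^sub>1 \<otimes> \<dots> \<otimes> a\<^sub>n\<close> is treated as one word whose first letter is the coefficient.
  Face \<open>0\<close> is the right action of \<open>a\<^sub>1\<close> on the coefficient, which is where the twist enters, the last
  face is the left action of \<open>a\<^sub>n\<close>, and the others multiply neighbours.
\<close>

definition face :: "nat \<Rightarrow> 'a list \<Rightarrow> 'a list" where
  "face d ys = (if d = 0 then merge 0 (ys[1 := nakayama (ys ! 1)])
     else if Suc d < length ys then merge d ys
     else merge 0 (last ys # butlast ys))"

lemma face_Cons:
  assumes "as \<noteq> []"
  shows "face d (x # as) = (if d = 0 then x * nakayama (hd as) # tl as
     else if d < length as then x # merge (d - 1) as else last as * x # butlast as)"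
  using assms by (cases as) (auto simp: face_def merge_def nth_Cons' take_Cons' drop_Cons')

lemma slotwise_face:
  assumes "d \<le> Suc n"
  shows "slotwise scale (Suc (Suc n)) (Suc n) (face d)"
proof -
  have m: "slotwise scale (Suc (Suc n)) (Suc n) (merge d)" if "d \<le> n" for d
    using slotwise_merge[of d "Suc (Suc n)"] that by simp
  consider "d = 0" | "0 < d" "d \<le> n" | "d = Suc n" using assms by linarith
  then show ?thesis
  proof cases
    case 1
    have "slotwise scale (Suc (Suc n)) (Suc (Suc n)) (\<lambda>ys. ys[1 := nakayama (ys ! 1)])"
      by (rule slotwise_permute[where L = "\<lambda>p. if p = 1 then nakayama else id" and \<pi> = id])
        (auto simp: linear_endo_nakayama nth_list_update, simp add: linear_endo_def)
    from slotwise_comp[OF this m[of 0]] show ?thesis by (simp add: 1 face_def[abs_def])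
  next
    case 2
    have "slotwise scale (Suc (Suc n)) (Suc n) (face d) = slotwise scale (Suc (Suc n)) (Suc n) (merge d)"
      using 2 by (simp add: slotwise_def face_def)
    then show ?thesis using m 2 by simp
  next
    case 3
    let ?\<pi> = "\<lambda>p. if p = 0 then Suc n else p - 1"
    have "bij_betw ?\<pi> {..<Suc (Suc n)} {..<Suc (Suc n)}"
      by (rule bij_betw_byWitness[where f' = "\<lambda>q. if q = Suc n then 0 else Suc q"]) auto
    then have "slotwise scale (Suc (Suc n)) (Suc (Suc n)) (\<lambda>ys. last ys # butlast ys)"
      by (intro slotwise_permute[where L = "\<lambda>p. id" and \<pi> = ?\<pi>])
        (auto simp: linear_endo_def nth_Cons' nth_butlast last_conv_nth simp flip: length_greater_0_conv)
    from slotwise_comp[OF this m[of 0]]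
    have "slotwise scale (Suc (Suc n)) (Suc n) (\<lambda>ys. merge 0 (last ys # butlast ys))" by simp
    moreover have "slotwise scale (Suc (Suc n)) (Suc n) (face d)
        = slotwise scale (Suc (Suc n)) (Suc n) (\<lambda>ys. merge 0 (last ys # butlast ys))"
      using 3 by (simp add: slotwise_def face_def)
    ultimately show ?thesis by simp
  qed
qed

lemma length_face:
  "length ys = Suc (Suc n) \<Longrightarrow> d \<le> Suc n \<Longrightarrow> length (face d ys) = Suc n"
  using slotwise_face[of d n] by (simp add: slotwise_def)

text \<open>
  The simplicial identity.  The pair \<open>d = 0\<close>, \<open>e = 1\<close> is the multiplicativity of the Nakayama
  automorphism; the other pairs of overlapping faces are associativity, and faces that do not
  overlap commute up to the shift of the index.
\<close>

lemma face_face: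
  assumes "length ys = Suc (Suc (Suc n))" "d < e" "e \<le> Suc (Suc n)"
  shows "face d (face e ys) = face (e - 1) (face d ys)"
proof -
  obtain x as where ys: "ys = x # as" and as: "length as = Suc (Suc n)"
    using assms(1) by (cases ys) auto
  obtain a b bs where ab: "as = a # b # bs" "length bs = n"
    using as by (metis length_Suc_conv)
  show ?thesis
  proof (cases "d = 0")
    case True
    show ?thesis
    proof (cases "e = 1")
      case True
      then show ?thesis using \<open>d = 0\<close> ab
        by (auto simp: ys face_Cons nakayama_mult mult.assoc)
    next
      case False
      show ?thesis
      proof (cases "e < length as")
        case True
        have "e = Suc (Suc (e - 2))" using False assms(2) \<open>d = 0\<close> by linarith
        then obtain e' where "e = Suc (Suc e')" by blast
        then show ?thesis using \<open>d = 0\<close> ab True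
          by (simp add: ys face_Cons)
      next
        case False
        then have "e = Suc (Suc n)" using assms(3) as by simp
        then show ?thesis using \<open>d = 0\<close> ab
          by (auto simp: ys face_Cons mult.assoc)
      qed
    qed
  next
    case False
    show ?thesis
    proof (cases "e < length as")
      case True
      have nonempty: "merge (e - 1) as \<noteq> []" "merge (d - 1) as \<noteq> []" by (auto simp: merge_def)
      have "merge (d - 1) (merge (e - 1) as) = merge (e - 1 - 1) (merge (d - 1) as)"
        using assms False True by (intro merge_merge) auto
      moreover have "as \<noteq> []" "e - Suc 0 < Suc n" "d < Suc (Suc n)" "d < Suc n"
        using as True assms(2) by auto
      ultimately show ?thesis using False True assms as nonempty
        by (simp add: ys face_Cons)
    next
      case F2: False
      then have e: "e = Suc (Suc n)" using assms(3) as by simp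
      have ne: "merge (d - 1) as \<noteq> []" "butlast as \<noteq> []" using ab by (auto simp: merge_def)
      show ?thesis
      proof (cases "d < Suc n")
        case True
        have "last (merge (d - 1) as) = last as" "butlast (merge (d - 1) as) = merge (d - 1) (butlast as)"
          using True False as by (auto intro: last_merge butlast_merge)
        then show ?thesis using F2 False True as ne ab
          by (auto simp: ys face_Cons e)
      next
        case F3: False
        then have d: "d = Suc n" using assms(2) e by simp
        obtain cs u v where cs: "as = cs @ [u, v]" "length cs = n"
          using as
          by (metis append_eq_conv_conj append_take_drop_id length_append_singleton length_Suc_conv_rev
              append_Cons append_Nil append_assoc)
        have "merge n as = cs @ [u * v]"
          using merge_append2[of cs 0 "[u, v]"] cs by simp
        then show ?thesis using cs
          by (simp add: ys face_Cons e d mult.assoc butlast_append)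
      qed
    qed
  qed
qed

section \<open>The cochain complex in terms of face maps\<close>

abbreviation "cochains_Nd \<equiv> cochains scale carrier_Nd scale_Nd"
abbreviation "coboundary_Nd \<equiv> coboundary_map scale_Nd actl_Nd actr_Nd"
abbreviation "boundary_N \<equiv> boundary_map actl_N actr_N"

text \<open>
  A cochain with values in the dual bimodule is a function of a word, the argument of the
  functional being the first letter, the slot of the coefficient of a chain.
\<close>

definition uncurried :: "('a list \<Rightarrow> 'a \<Rightarrow> 'k) \<Rightarrow> 'a list \<Rightarrow> 'k" where
  "uncurried f ys = f (tl ys) (hd ys)"

lemma uncurried_Cons [simp]: "uncurried f (x # as) = f as x"
  by (simp add: uncurried_def)

lemma cochains_Nd_iff:
  "f \<in> cochains_Nd n \<longleftrightarrow>
     (\<forall>as. length as \<noteq> n \<longrightarrow> f as = 0) \<and> multilin scale (\<lambda>c. c) (Suc n) (uncurried f)"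
  (is "?L \<longleftrightarrow> ?R")
proof
  assume f: ?L
  have "multilin scale (\<lambda>c. c) (Suc n) (uncurried f)"
    unfolding multilin_def
  proof (intro allI impI)
    fix ys :: "'a list" and i
    assume ys: "length ys = Suc n" "i < Suc n"
    then obtain x as where [simp]: "ys = x # as" and as: "length as = n"
      by (cases ys) auto
    show "(\<forall>x y. uncurried f (ys[i := x + y]) = uncurried f (ys[i := x]) + uncurried f (ys[i := y])) \<and>
      (\<forall>c x. uncurried f (ys[i := c *s x]) = c * uncurried f (ys[i := x]))"
    proof (cases i)
      case 0
      then show ?thesis using f by (auto simp: cochains_def carrier_Nd_def)
    next
      case (Suc j)
      then show ?thesis using f as ys(2) by (auto simp: cochains_def scale_Nd_def)
    qed
  qed
  then show ?R using f by (auto simp: cochains_def)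
next
  assume f: ?R
  then have add: "uncurried f (ys[i := x + y]) = uncurried f (ys[i := x]) + uncurried f (ys[i := y])"
    and sc: "uncurried f (ys[i := c *s x]) = c * uncurried f (ys[i := x])"
    if "length ys = Suc n" "i < Suc n" for ys i x y c
    using that unfolding multilin_def by blast+
  have "f as \<in> carrier_Nd" for as
  proof (cases "length as = n")
    case True
    then show ?thesis using add[of "0 # as" 0] sc[of "0 # as" 0] by (simp add: carrier_Nd_def)
  next
    case False
    then show ?thesis using f by (simp add: carrier_Nd_def)
  qed
  moreover have "f (as[i := x + y]) = f (as[i := x]) + f (as[i := y])"
    "f (as[i := c *s x]) = scale_Nd c (f (as[i := x]))" if "length as = n" "i < n" for as i x y c
    using add[of "_ # as" "Suc i" x y] sc[of "_ # as" "Suc i" c x] that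
    by (auto simp: scale_Nd_def)
  ultimately show ?L using f by (simp add: cochains_def)
qed

lemma cochain_length: "f \<in> cochains_Nd n \<Longrightarrow> length as \<noteq> n \<Longrightarrow> f as = 0"
  by (simp add: cochains_Nd_iff)

lemma uncurried_coboundary:
  assumes "length ys = Suc (Suc n)"
  shows "uncurried (coboundary_Nd n f) ys = (\<Sum>d\<le>Suc n. (-1) ^ d * uncurried f (face d ys))"
proof -
  obtain x as where ys: "ys = x # as" and as: "length as = Suc n"
    using assms by (cases ys) auto
  have ne: "as \<noteq> []" using as by auto
  have "(\<Sum>d\<le>Suc n. (-1) ^ d * uncurried f (face d ys))
     = uncurried f (face 0 ys) + (\<Sum>d<n. (-1) ^ Suc d * uncurried f (face (Suc d) ys))
       + (-1) ^ Suc n * uncurried f (face (Suc n) ys)"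
    by (simp add: sum.atMost_shift)
  also have "(\<Sum>d<n. (-1) ^ Suc d * uncurried f (face (Suc d) ys))
     = (\<Sum>d<n. (-1) ^ Suc d * f (merge d as) x)"
    using as by (intro sum.cong) (simp_all add: ys face_Cons[OF ne])
  also have "uncurried f (face 0 ys) = f (tl as) (x * nakayama (hd as))"
    by (simp add: ys face_Cons[OF ne])
  also have "uncurried f (face (Suc n) ys) = f (butlast as) (last as * x)"
    using as by (simp add: ys face_Cons[OF ne])
  finally show ?thesis using as
    by (simp add: ys coboundary_map_def actl_Nd_def actr_Nd_def scale_Nd_def sum_fun_apply)
qed

lemma coboundary_length: "length as \<noteq> Suc n \<Longrightarrow> coboundary_Nd n f as = 0"
  by (simp add: coboundary_map_def)

lemma coboundary_cochain:
  assumes "f \<in> cochains_Nd n"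
  shows "coboundary_Nd n f \<in> cochains_Nd (Suc n)"
proof -
  have "multilin scale (\<lambda>c. c) (Suc (Suc n)) (\<lambda>ys. \<Sum>d\<le>Suc n. (-1) ^ d * uncurried f (face d ys))"
    using assms
    by (intro multilin_sum multilin_comp_slotwise[OF _ slotwise_face])
      (auto simp: cochains_Nd_iff)
  then have "multilin scale (\<lambda>c. c) (Suc (Suc n)) (uncurried (coboundary_Nd n f))"
    by (subst multilin_cong[OF uncurried_coboundary])
  then show ?thesis by (simp add: cochains_Nd_iff coboundary_length)
qed

text \<open>
  The term at \<open>(e, d)\<close> with \<open>d < e\<close> cancels the one at \<open>(d, e - 1)\<close>.
\<close>

lemma alternating_sum_cancel:
  fixes c :: "nat \<Rightarrow> nat \<Rightarrow> 'r::comm_ring_1"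
  assumes "\<And>d e. d < e \<Longrightarrow> e \<le> Suc m \<Longrightarrow> c d e = c (e - 1) d"
  shows "(\<Sum>e\<le>Suc m. \<Sum>d\<le>m. (-1) ^ e * ((-1) ^ d * c d e)) = 0"
proof -
  define A where "A = {(e, d). d < e \<and> e \<le> Suc m}"
  define B where "B = {(e, d). e \<le> d \<and> d \<le> m}"
  let ?t = "\<lambda>(e, d). (-1) ^ e * ((-1) ^ d * c d e)"
  have "A \<subseteq> {..Suc m} \<times> {..m}" "B \<subseteq> {..Suc m} \<times> {..m}" by (auto simp: A_def B_def)
  then have fin: "finite A" "finite B" by (auto intro: finite_subset)
  have "sum ?t A = (\<Sum>x\<in>B. - ?t x)"
    by (rule sum.reindex_bij_witness[where i = "\<lambda>(e, d). (Suc d, e)" and j = "\<lambda>(e, d). (d, e - 1)"])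
      (auto simp: A_def B_def assms power_Suc elim!: less_natE)
  then have "sum ?t A + sum ?t B = 0" by (simp add: sum_negf)
  moreover have "sum ?t A + sum ?t B = sum ?t (A \<union> B)"
    using fin by (intro sum.union_disjoint[symmetric]) (auto simp: A_def B_def)
  moreover have "A \<union> B = {..Suc m} \<times> {..m}" by (auto simp: A_def B_def)
  ultimately show ?thesis by (simp add: sum.cartesian_product)
qed

lemma coboundary_coboundary: "coboundary_Nd (Suc n) (coboundary_Nd n f) = 0"
proof (intro ext)
  fix as x
  show "coboundary_Nd (Suc n) (coboundary_Nd n f) as x = (0 :: 'a list \<Rightarrow> 'a \<Rightarrow> 'k) as x"
  proof (cases "length as = Suc (Suc n)")
    case True
    let ?ys = "x # as"
    have "uncurried (coboundary_Nd (Suc n) (coboundary_Nd n f)) ?ys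
      = (\<Sum>e\<le>Suc (Suc n). (-1) ^ e * (\<Sum>d\<le>Suc n. (-1) ^ d * uncurried f (face d (face e ?ys))))"
      using True by (simp add: uncurried_coboundary length_face del: sum.atMost_Suc uncurried_Cons)
    also have "\<dots> = (\<Sum>e\<le>Suc (Suc n). \<Sum>d\<le>Suc n. (-1) ^ e * ((-1) ^ d * uncurried f (face d (face e ?ys))))"
      by (simp only: sum_distrib_left)
    also have "\<dots> = 0"
      using True by (intro alternating_sum_cancel arg_cong[where f = "uncurried f"] face_face) auto
    finally show ?thesis by simp
  qed (simp add: coboundary_length)
qed

lemma eval_chain_eq_pairing: "eval_chain f p = pairing (\<lambda>(x, as). f as x) p"
  by (simp add: eval_chain_def pairing_def case_prod_unfold)

text \<open>
  The actions on the dual bimodule are the transposes of those on the twisted bimodule, with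
  left and right exchanged, so coboundary and boundary are transposes with no sign.
\<close>

lemma eval_coboundary:
  assumes "p \<in> free_chains (Suc n)"
  shows "eval_chain (coboundary_Nd n f) p = eval_chain f (boundary_N (Suc n) p)"
proof -
  have "coboundary_Nd n f as x = pairing (\<lambda>(x, as). f as x)
      (gen (actr_N x (hd as), tl as)
       + (\<Sum>i<Suc n - 1. fscale ((-1) ^ Suc i) (gen (x, merge i as)))
       + fscale ((-1) ^ Suc n) (gen (actl_N (last as) x, butlast as)))"
    if "(x, as) \<in> Poly_Mapping.keys p" for x as
  proof -
    have "length as = Suc n" using assms that by (auto simp: free_chains_def)
    then show ?thesis
      by (simp only: pairing_add pairing_sum pairing_fscale pairing_gen)
        (simp add: coboundary_map_def actl_Nd_def actr_Nd_def scale_Nd_def sum_fun_apply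
          actl_N_def actr_N_def)
  qed
  then show ?thesis
    by (auto simp: eval_chain_eq_pairing boundary_map_def pairing_lin_ext intro!: pairing_cong)
qed

lemma eval_tensor_rel:
  assumes f: "f \<in> cochains_Nd n" and r: "r \<in> tensor_rel_N n"
  shows "eval_chain f r = 0"
proof -
  have mul: "multilin scale (\<lambda>c. c) (Suc n) (uncurried f)" using f by (simp add: cochains_Nd_iff)
  have sub: "free.subspace {r. eval_chain f r = 0}"
    by (auto simp: free.subspace_def eval_chain_eq_pairing pairing_add pairing_fscale)
  have 0: "f as (x + y) = f as x + f as y" "f as (c *s x) = c * f as x" for as x y c
    using f by (auto simp: cochains_def carrier_Nd_def)
  have i: "f (as[i := x + y]) z = f (as[i := x]) z + f (as[i := y]) z"
    "f (as[i := c *s x]) z = c * f (as[i := x]) z" if "length as = n" "i < n" for as i x y c z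
    using f that by (auto simp: cochains_def scale_Nd_def)
  have "tensor_rel_N n \<subseteq> {r. eval_chain f r = 0}"
    unfolding tensor_rel_def
    by (rule free.span_minimal[OF _ sub])
      (auto simp: eval_chain_eq_pairing pairing_diff pairing_fscale 0 i)
  then show ?thesis using r by blast
qed

section \<open>The action of the Nakayama automorphism\<close>

definition twist_cochain :: "('a list \<Rightarrow> 'a \<Rightarrow> 'k) \<Rightarrow> 'a list \<Rightarrow> 'a \<Rightarrow> 'k" where
  "twist_cochain f = (\<lambda>as x. f (map nakayama as) (nakayama x))"

definition twist_chain :: "('a \<times> 'a list \<Rightarrow>\<^sub>0 'k) \<Rightarrow> ('a \<times> 'a list \<Rightarrow>\<^sub>0 'k)" where
  "twist_chain = lin_ext (\<lambda>(x, as). gen (nakayama x, map nakayama as))"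

lemma eval_twist: "eval_chain (twist_cochain f) p = eval_chain f (twist_chain p)"
  by (simp add: eval_chain_eq_pairing twist_chain_def pairing_lin_ext case_prod_unfold twist_cochain_def)

lemma uncurried_twist: "ys \<noteq> [] \<Longrightarrow> uncurried (twist_cochain f) ys = uncurried f (map nakayama ys)"
  by (cases ys) (auto simp: twist_cochain_def)

lemma twist_cochain_cochain:
  assumes "f \<in> cochains_Nd n"
  shows "twist_cochain f \<in> cochains_Nd n"
proof -
  have "multilin scale (\<lambda>c. c) (Suc n) (\<lambda>ys. uncurried f (map nakayama ys))"
    using assms by (intro multilin_comp_slotwise[OF _ slotwise_map])
      (auto simp: cochains_Nd_iff linear_endo_nakayama)
  then have "multilin scale (\<lambda>c. c) (Suc n) (uncurried (twist_cochain f))"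
    by (subst multilin_cong[OF uncurried_twist]) auto
  then show ?thesis using assms by (auto simp: cochains_Nd_iff twist_cochain_def zero_fun_def)
qed

lemma map_nakayama_face:
  assumes "length ys = Suc (Suc n)"
  shows "map nakayama (face d ys) = face d (map nakayama ys)"
proof -
  obtain x a as where "ys = x # a # as" "length as = n"
    using assms by (metis length_Suc_conv)
  then show ?thesis
    by (auto simp: face_Cons nakayama_mult map_merge map_butlast last_map)
qed

lemma twist_coboundary: "coboundary_Nd n (twist_cochain f) = twist_cochain (coboundary_Nd n f)"
proof (intro ext)
  fix as x
  show "coboundary_Nd n (twist_cochain f) as x = twist_cochain (coboundary_Nd n f) as x"
  proof (cases "length as = Suc n")
    case True
    let ?ys = "x # as"
    have ne: "face d ?ys \<noteq> []" if "d \<le> Suc n" for d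
      using length_face[of ?ys n d] True that by auto
    have "uncurried (coboundary_Nd n (twist_cochain f)) ?ys
        = (\<Sum>d\<le>Suc n. (-1) ^ d * uncurried f (face d (map nakayama ?ys)))"
      using True
      by (subst uncurried_coboundary)
        (auto intro!: sum.cong simp: uncurried_twist ne map_nakayama_face[where n = n]
          simp del: sum.atMost_Suc list.map)
    also have "\<dots> = uncurried (coboundary_Nd n f) (map nakayama ?ys)"
      using True by (subst uncurried_coboundary) auto
    finally show ?thesis by (simp add: twist_cochain_def)
  qed (simp add: coboundary_length twist_cochain_def)
qed

section \<open>The twisted Connes operator\<close>

text \<open>
  The words of the Connes operator, numbered so that \<open>rot i\<close> is the twisted word of index \<open>i + 1\<close>
  and \<open>rot n\<close> is the one of index \<open>0\<close>.  The letter \<open>a\<^sub>0\<close> thus moves to the left step by step, which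
  makes the case analysis below uniform; the signs are compatible because \<open>(n + 1) n\<close> is even.
\<close>

definition rot :: "nat \<Rightarrow> 'a list \<Rightarrow> 'a list" where
  "rot i ys = drop i (tl ys) @ [hd ys] @ map nakayama (take i (tl ys))"

lemma length_rot [simp]: "ys \<noteq> [] \<Longrightarrow> length (rot i ys) = length ys"
  by (cases ys) (auto simp: rot_def)

lemma Bbar_cochain_rot:
  assumes "length ys = Suc n"
  shows "uncurried (Bbar_cochain n f) ys = (\<Sum>i\<le>n. (-1) ^ (Suc i * n) * uncurried f (1 # rot i ys))"
proof -
  obtain x as where ys: "ys = x # as" and as: "length as = n"
    using assms by (cases ys) auto
  have "even (Suc n * n)" by simp
  then have sign: "(-1) ^ (Suc n * n) = (1 :: 'k)" by (rule neg_one_even_power)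
  have "uncurried (Bbar_cochain n f) ys = (\<Sum>i\<le>n. (-1) ^ (i * n) * f (twisted_word i x as) 1)"
    using as by (simp add: ys Bbar_cochain_def)
  also have "\<dots> = f (twisted_word 0 x as) 1 + (\<Sum>i<n. (-1) ^ (Suc i * n) * f (twisted_word (Suc i) x as) 1)"
    by (simp add: sum.atMost_shift)
  also have "\<dots> = (\<Sum>i<n. (-1) ^ (Suc i * n) * uncurried f (1 # rot i ys))
      + (-1) ^ (Suc n * n) * uncurried f (1 # rot n ys)"
    using as by (simp only: sign) (simp add: ys twisted_word_def rot_def)
  also have "\<dots> = (\<Sum>i\<le>n. (-1) ^ (Suc i * n) * uncurried f (1 # rot i ys))"
    by (simp only: lessThan_Suc_atMost[symmetric] sum.lessThan_Suc)
  finally show ?thesis .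
qed

lemma slotwise_rot:
  assumes "i \<le> n"
  shows "slotwise scale (Suc n) (Suc n) (rot i)"
proof (rule slotwise_permute)
  let ?\<pi> = "\<lambda>p. if p < n - i then i + p + 1 else p - (n - i)"
  show "bij_betw ?\<pi> {..<Suc n} {..<Suc n}"
    using assms
    by (intro bij_betw_byWitness[where f' = "\<lambda>q. if i < q then q - i - 1 else q + (n - i)"]) auto
  show "rot i ys ! p = (if p \<le> n - i then id else nakayama) (ys ! ?\<pi> p)"
    if "length ys = Suc n" "p < Suc n" for ys p
  proof -
    obtain x as where ys: "ys = x # as" and as: "length as = n"
      using \<open>length ys = Suc n\<close> by (cases ys) auto
    have "p < n - i \<or> p = n - i \<or> p = Suc (n - i + (p - Suc (n - i))) \<and> p - Suc (n - i) < i"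
      using that(2) assms by arith
    then consider "p < n - i" | "p = n - i" | q where "p = Suc (n - i + q)" "q < i" by blast
    then show ?thesis
    proof cases
      case 3
      then show ?thesis using assms as by (auto simp: ys rot_def nth_append)
    qed (use assms as in \<open>simp_all add: ys rot_def nth_append\<close>)
  qed
  show "length (rot i ys) = Suc n" if "length ys = Suc n" for ys
    using that by (subst length_rot) auto
  show "linear_endo scale (if p \<le> n - i then id else nakayama)" for p
    using linear_endo_nakayama by (simp add: linear_endo_def)
qed

lemma Bbar_cochain_cochain:
  assumes "f \<in> cochains_Nd (Suc n)"
  shows "Bbar_cochain n f \<in> cochains_Nd n"
proof -
  have "multilin scale (\<lambda>c. c) (Suc (Suc n)) (uncurried f)"
    using assms by (simp add: cochains_Nd_iff)
  then have "multilin scale (\<lambda>c. c) (Suc n) (\<lambda>ys. uncurried f (1 # rot i ys))" if "i \<le> n" for i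
    using slotwise_comp[OF slotwise_rot[OF that] slotwise_Cons[of scale "Suc n" 1]]
    by (rule multilin_comp_slotwise)
  then have "multilin scale (\<lambda>c. c) (Suc n)
      (\<lambda>ys. \<Sum>i\<in>{..n}. (-1) ^ (Suc i * n) * uncurried f (1 # rot i ys))"
    by (intro multilin_sum) simp
  then have "multilin scale (\<lambda>c. c) (Suc n) (uncurried (Bbar_cochain n f))"
    by (subst multilin_cong[OF Bbar_cochain_rot])
  then show ?thesis by (simp add: cochains_Nd_iff Bbar_cochain_def)
qed

lemma eval_Bbar:
  assumes "p \<in> free_chains n"
  shows "eval_chain (Bbar_cochain n f) p = eval_chain f (B_chain n p)"
  unfolding eval_chain_eq_pairing B_chain_def
  using assms
  by (auto simp: pairing_lin_ext free_chains_def case_prod_unfold pairing_sum pairing_fscale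
      Bbar_cochain_def intro!: pairing_cong)

text \<open>
  Multiplying neighbours in a rotated word gives the rotation of a face.  This case covers the
  products \<open>a\<^sub>k\<^sub>+\<^sub>1 a\<^sub>k\<^sub>+\<^sub>2\<close> of letters in front of \<open>a\<^sub>0\<close> and the product \<open>a\<^sub>n a\<^sub>0\<close>.
\<close>

lemma merge_rot_inner:
  assumes "length ys = Suc n" "i \<le> k" "k < n"
  shows "merge (k - i) (rot i ys) = rot i (face (Suc k) ys)"
proof -
  obtain x as where ys: "ys = x # as" and as: "length as = n"
    using assms(1) by (cases ys) auto
  have ne: "as \<noteq> []" using as assms by auto
  show ?thesis
  proof (cases "Suc k < n")
    case True
    have "take i (merge k as) = take i as"
      using assms True as by (auto simp: merge_def min_def)
    moreover have "drop i (merge k as) = merge (k - i) (drop i as)"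
      using assms True as by (intro merge_take_drop) auto
    moreover have "merge (k - i) (drop i as @ v) = merge (k - i) (drop i as) @ v" for v
      using assms True as by (intro merge_append1) auto
    ultimately show ?thesis
      using True as by (simp add: ys face_Cons[OF ne] rot_def)
  next
    case False
    then have k: "n = Suc k" using assms by simp
    obtain bs z where bs: "as = bs @ [z]" "length bs = k"
      using as k by (metis length_Suc_conv_rev)
    then show ?thesis
      using assms k merge_append2[of "drop i bs" 0]
      by (simp add: ys face_Cons rot_def)
  qed
qed

text \<open>
  The remaining products: \<open>a\<^sub>0 N(a\<^sub>1)\<close> for \<open>k = 0\<close>, and \<open>N(a\<^sub>k) N(a\<^sub>k\<^sub>+\<^sub>1) = N(a\<^sub>k a\<^sub>k\<^sub>+\<^sub>1)\<close> behind \<open>a\<^sub>0\<close>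
  otherwise.
\<close>

lemma merge_rot_outer:
  assumes "length ys = Suc n" "k \<le> i" "i < n"
  shows "merge (n - Suc i + k) (rot (Suc i) ys) = rot i (face k ys)"
proof -
  obtain x as where ys: "ys = x # as" and as: "length as = n"
    using assms(1) by (cases ys) auto
  have ne: "as \<noteq> []" using as assms by auto
  have "merge (n - Suc i + k) (rot (Suc i) ys)
      = drop (Suc i) as @ merge k (x # map nakayama (take (Suc i) as))"
    using merge_append2[of "drop (Suc i) as" k "x # map nakayama (take (Suc i) as)"] as
    by (simp add: ys rot_def)
  also have "\<dots> = rot i (face k ys)"
  proof (cases k)
    case 0
    obtain a bs where "as = a # bs" using ne by (cases as) auto
    then show ?thesis using 0 by (simp add: ys face_Cons rot_def)
  next
    case (Suc k')
    have lt: "Suc k' < length (take (Suc i) as)" using assms Suc as by simp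
    have m: "merge k' as = merge k' (take (Suc i) as) @ drop (Suc i) as"
      using merge_append1[OF lt, of "drop (Suc i) as"] by simp
    have "length (merge k' (take (Suc i) as)) = i" using lt assms as by simp
    then have "drop i (merge k' as) = drop (Suc i) as"
      "take i (merge k' as) = merge k' (take (Suc i) as)" by (simp_all add: m)
    moreover have "map nakayama (merge k' (take (Suc i) as)) = merge k' (map nakayama (take (Suc i) as))"
      using lt by (intro map_merge nakayama_mult)
    ultimately show ?thesis using Suc assms as
      by (simp add: ys face_Cons[OF ne] rot_def)
  qed
  finally show ?thesis .
qed

text \<open>
  The inner faces of \<open>Bbar \<delta>\<close> against all of \<open>\<delta> Bbar\<close>.  Rotating the face of index \<open>d\<close> by \<open>i\<close> arises
  from exactly one product of neighbours in a rotated word: by \<open>merge_rot_inner\<close> if \<open>i < d\<close>, from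
  rotation \<open>i\<close>, and by \<open>merge_rot_outer\<close> if \<open>d \<le> i\<close>, from rotation \<open>i + 1\<close>.  The signs are opposite
  in both cases.
\<close>

lemma merge_terms_cancel:
  assumes "length ys = Suc (Suc m)"
  shows "(\<Sum>i\<le>Suc m. (-1) ^ (Suc i * Suc m) *
        (\<Sum>j<Suc m. (-1) ^ Suc j * uncurried f (1 # merge j (rot i ys))))
    + (\<Sum>d\<le>Suc m. (-1) ^ d * (\<Sum>i\<le>m. (-1) ^ (Suc i * m) * uncurried f (1 # rot i (face d ys)))) = 0"
proof -
  let ?l = "\<lambda>(i, j). (-1) ^ (Suc i * Suc m) * ((-1) ^ Suc j * uncurried f (1 # merge j (rot i ys)))"
  let ?r = "\<lambda>(i, d). - ((-1) ^ d * ((-1) ^ (Suc i * m) * uncurried f (1 # rot i (face d ys))))"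
  let ?to = "\<lambda>(i, j). if i + j \<le> m then (i, Suc (i + j)) else (i - 1, i + j - Suc m)"
  let ?from = "\<lambda>(i, d). if i < d then (i, d - Suc i) else (Suc i, m - i + d)"
  have "sum ?l ({..Suc m} \<times> {..<Suc m}) = sum ?r ({..m} \<times> {..Suc m})"
  proof (rule sum.reindex_bij_witness[where i = ?from and j = ?to])
    fix p assume "p \<in> {..Suc m} \<times> {..<Suc m}"
    then obtain i j where p: "p = (i, j)" "i \<le> Suc m" "j \<le> m" by auto
    show "?from (?to p) = p" "?to p \<in> {..m} \<times> {..Suc m}" using p by auto
    show "?r (?to p) = ?l p"
    proof (cases "i + j \<le> m")
      case True
      have "merge j (rot i ys) = rot i (face (Suc (i + j)) ys)"
        using merge_rot_inner[OF assms, of i "i + j"] True by simp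
      moreover have "(-1) ^ (Suc i * Suc m) * (-1) ^ Suc j = - ((-1) ^ Suc (i + j) * (-1) ^ (Suc i * m) :: 'k)"
        by (simp add: algebra_simps power_add)
      ultimately show ?thesis using True p by (simp add: mult.assoc[symmetric])
    next
      case False
      then obtain k where k: "i + j = Suc m + k" by (metis not_less_eq_eq le_Suc_ex)
      obtain i' where i: "i = Suc i'" using False p by (cases i) auto
      have le: "k \<le> i'" "i' \<le> m" using k i p by auto
      have j: "j = Suc m - Suc i' + k" using k i le by simp
      have "merge j (rot i ys) = rot i' (face k ys)"
        using merge_rot_outer[OF assms le(1)] le(2) by (simp add: i j)
      \<comment> \<open>The exponents differ by the odd number \<open>2 m + 3\<close>.\<close>
      moreover have "Suc i * Suc m + Suc j = k + Suc i' * m + (2 * m + 3)"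
        using k by (simp add: i algebra_simps)
      then have "(-1) ^ (Suc i * Suc m) * (-1) ^ Suc j = - ((-1) ^ k * (-1) ^ (Suc i' * m) :: 'k)"
        by (simp only: power_add[symmetric]) (simp add: power_add power_mult)
      ultimately show ?thesis using False p k i by (simp add: mult.assoc[symmetric])
    qed
  next
    fix p assume "p \<in> {..m} \<times> {..Suc m}"
    then obtain i d where p: "p = (i, d)" "i \<le> m" "d \<le> Suc m" by auto
    show "?to (?from p) = p" "?from p \<in> {..Suc m} \<times> {..<Suc m}" using p by auto
  qed
  moreover have "sum ?r ({..m} \<times> {..Suc m})
      = - (\<Sum>d\<le>Suc m. (-1) ^ d * (\<Sum>i\<le>m. (-1) ^ (Suc i * m) * uncurried f (1 # rot i (face d ys))))"
    by (simp only: sum.cartesian_product[symmetric] sum_distrib_left sum_negf)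
      (rule arg_cong[where f = uminus, OF sum.swap])
  moreover have "sum ?l ({..Suc m} \<times> {..<Suc m}) = (\<Sum>i\<le>Suc m. (-1) ^ (Suc i * Suc m) *
        (\<Sum>j<Suc m. (-1) ^ Suc j * uncurried f (1 # merge j (rot i ys))))"
    by (simp only: sum.cartesian_product[symmetric] sum_distrib_left)
  ultimately show ?thesis by (simp only: neg_eq_iff_add_eq_0) simp
qed

text \<open>
  The two outer faces of \<open>Bbar \<delta>\<close> telescope: the first face of rotation \<open>i\<close> is the last face of
  rotation \<open>i + 1\<close> (\<open>h i = l (i + 1)\<close> below), with the opposite sign.  What is left is the first
  face of the last rotation, where all letters are twisted, and the last face of rotation \<open>0\<close>, where
  none is.
\<close>

lemma Bbar_coboundary:
  assumes "length ys = Suc n"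
  shows "uncurried (Bbar_cochain n (coboundary_Nd n f)) ys
    = uncurried (twist_cochain f) ys - uncurried f ys
      + (\<Sum>i\<le>n. (-1) ^ (Suc i * n) * (\<Sum>j<n. (-1) ^ Suc j * uncurried f (1 # merge j (rot i ys))))"
proof -
  obtain x as where ys: "ys = x # as" and as: "length as = n"
    using assms by (cases ys) auto
  define h where "h i = f (tl (rot i ys)) (nakayama (hd (rot i ys)))" for i
  define l where "l i = f (butlast (rot i ys)) (last (rot i ys))" for i
  define s where "s i = ((-1) ^ (Suc i * n) :: 'k)" for i
  have hl: "h i = l (Suc i)" if "i < n" for i
  proof -
    have "drop i as = as ! i # drop (Suc i) as" using that as by (simp add: Cons_nth_drop_Suc)
    then show ?thesis using that as
      by (simp add: h_def l_def ys rot_def take_Suc_conv_app_nth butlast_append)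
  qed
  have step: "s i * h i + s (Suc i) * ((-1) ^ Suc n * l (Suc i)) = 0" if "i < n" for i
  proof -
    have "s (Suc i) * (-1) ^ Suc n = - s i"
      by (simp add: s_def power_add mult.assoc flip: power_mult_distrib)
    then have "s (Suc i) * ((-1) ^ Suc n * l (Suc i)) = - s i * l (Suc i)"
      by (simp only: mult.assoc[symmetric])
    then show ?thesis by (simp only: hl[OF that] mult_minus_left add.right_inverse)
  qed
  have "even (Suc n * n)" by simp
  then have sn: "s n = 1" unfolding s_def by (rule neg_one_even_power)
  have s0: "s 0 * (-1) ^ Suc n = -1"
    by (simp add: s_def flip: power_mult_distrib)
  have "(\<Sum>i\<le>n. s i * h i) + (\<Sum>i\<le>n. s i * ((-1) ^ Suc n * l i))
      = (\<Sum>i<n. s i * h i) + s n * h n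
        + (s 0 * ((-1) ^ Suc n * l 0) + (\<Sum>i<n. s (Suc i) * ((-1) ^ Suc n * l (Suc i))))"
    by (simp only: sum.atMost_shift[of "\<lambda>i. s i * ((-1) ^ Suc n * l i)"])
      (simp only: lessThan_Suc_atMost[symmetric] sum.lessThan_Suc)
  also have "\<dots> = s n * h n + s 0 * (-1) ^ Suc n * l 0
      + (\<Sum>i<n. s i * h i + s (Suc i) * ((-1) ^ Suc n * l (Suc i)))"
    by (simp only: sum.distrib) (simp add: algebra_simps)
  also have "\<dots> = h n - l 0"
    using step by (simp add: sn s0 del: power_Suc)
  also have "h n = uncurried (twist_cochain f) ys"
    using as by (simp add: h_def ys rot_def twist_cochain_def)
  also have "l 0 = uncurried f ys"
    using as by (simp add: l_def ys rot_def)
  finally have *: "(\<Sum>i\<le>n. s i * h i) + (\<Sum>i\<le>n. s i * ((-1) ^ Suc n * l i))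
      = uncurried (twist_cochain f) ys - uncurried f ys" .
  have "uncurried (Bbar_cochain n (coboundary_Nd n f)) ys
      = (\<Sum>i\<le>n. s i * coboundary_Nd n f (rot i ys) 1)"
    using assms by (simp add: Bbar_cochain_rot s_def)
  also have "\<dots> = (\<Sum>i\<le>n. s i * h i + s i * (\<Sum>j<n. (-1) ^ Suc j * uncurried f (1 # merge j (rot i ys)))
      + s i * ((-1) ^ Suc n * l i))"
  proof (intro sum.cong refl)
    fix i
    have "length (rot i ys) = Suc n" using assms by (subst length_rot) auto
    then have "coboundary_Nd n f (rot i ys) 1
      = h i + (\<Sum>j<n. (-1) ^ Suc j * f (merge j (rot i ys)) 1) + (-1) ^ Suc n * l i"
      by (simp add: coboundary_map_def actl_Nd_def actr_Nd_def scale_Nd_def sum_fun_apply h_def l_def)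
    then show "s i * coboundary_Nd n f (rot i ys) 1
      = s i * h i + s i * (\<Sum>j<n. (-1) ^ Suc j * uncurried f (1 # merge j (rot i ys)))
        + s i * ((-1) ^ Suc n * l i)"
      by (simp only: distrib_left uncurried_Cons)
  qed
  also have "\<dots> = uncurried (twist_cochain f) ys - uncurried f ys
      + (\<Sum>i\<le>n. s i * (\<Sum>j<n. (-1) ^ Suc j * uncurried f (1 # merge j (rot i ys))))"
    unfolding *[symmetric] by (simp only: sum.distrib) (simp add: algebra_simps)
  finally show ?thesis by (simp only: s_def)
qed

text \<open>
  The transpose of \<open>b B + B b = T - 1\<close> on unnormalized chains: the inner faces cancel, and the outer
  ones telescope to \<open>T\<^sup>* - 1\<close>.
\<close>

lemma Bbar_homotopy:
  assumes f: "f \<in> cochains_Nd (Suc m)"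
  shows "twist_cochain f - f
    = Bbar_cochain (Suc m) (coboundary_Nd (Suc m) f) + coboundary_Nd m (Bbar_cochain m f)"
proof (intro ext)
  fix as x
  show "(twist_cochain f - f) as x
    = (Bbar_cochain (Suc m) (coboundary_Nd (Suc m) f) + coboundary_Nd m (Bbar_cochain m f)) as x"
  proof (cases "length as = Suc m")
    case True
    let ?ys = "x # as"
    have "uncurried (coboundary_Nd m (Bbar_cochain m f)) ?ys = (\<Sum>d\<le>Suc m. (-1) ^ d *
        (\<Sum>i\<le>m. (-1) ^ (Suc i * m) * uncurried f (1 # rot i (face d ?ys))))"
      using True
      by (simp add: uncurried_coboundary Bbar_cochain_rot length_face del: sum.atMost_Suc uncurried_Cons)
    then have "uncurried (Bbar_cochain (Suc m) (coboundary_Nd (Suc m) f)) ?ys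
        + uncurried (coboundary_Nd m (Bbar_cochain m f)) ?ys
        = uncurried (twist_cochain f) ?ys - uncurried f ?ys"
      using Bbar_coboundary[of ?ys "Suc m" f] merge_terms_cancel[of ?ys m f] True
      by (simp only: length_Cons add.assoc add_0_right)
    then show ?thesis by simp
  next
    case False
    then show ?thesis
      using cochain_length[OF f] by (simp add: twist_cochain_def Bbar_cochain_def coboundary_length)
  qed
qed

lemma Bbar_homotopy_0:
  assumes f: "f \<in> cochains_Nd 0"
  shows "twist_cochain f - f = Bbar_cochain 0 (coboundary_Nd 0 f)"
proof (intro ext)
  fix as x
  show "(twist_cochain f - f) as x = Bbar_cochain 0 (coboundary_Nd 0 f) as x"
    using Bbar_coboundary[of "x # as" 0 f] cochain_length[OF f, of as]
      cochain_length[OF f, of "map nakayama as"]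
    by (cases "length as = 0") (simp_all add: twist_cochain_def Bbar_cochain_def)
qed

section \<open>Projecting to invariant cochains\<close>

text \<open>
  The \<open>\<phi> j\<close> are the rows of the base change matrix that diagonalizes the Nakayama automorphism over the
  algebraic closure, read as functionals on \<open>A\<close> with values there; they are eigenvectors of the
  transposed map.  The expansion writes an arbitrary such functional \<open>g\<close> in this basis.  Working
  with functionals on \<open>A\<close> itself avoids forming the scalar extension of \<open>A\<close>.
\<close>

lemma eigenfunctional_expansion:
  assumes nakayama_semisimple
  shows "\<exists>(d :: nat) (\<phi> :: nat \<Rightarrow> 'a \<Rightarrow> 'k alg_closure) \<mu> c b.
    (\<forall>j<d. \<forall>x. \<phi> j (nakayama x) = \<mu> j * \<phi> j x) \<and>
    (\<forall>g. (\<forall>x y. g (x + y) = g x + g y) \<longrightarrow> (\<forall>t x. g (t *s x) = to_ac t * g x) \<longrightarrow>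
       (\<forall>x. g x = (\<Sum>j<d. \<phi> j x * (\<Sum>i<d. c i j * g (b i)))))"
proof -
  obtain bs D where bs: "distinct bs" "independent (set bs)" "span (set bs) = UNIV"
    and D: "diagonal_mat D" "similar_mat (map_mat to_ac (nakayama_matrix bs)) D"
    using assms unfolding nakayama_semisimple_def by blast
  define d where "d = length bs"
  define M where "M = map_mat to_ac (nakayama_matrix bs)"
  have M_dim: "M \<in> carrier_mat d d" by (simp add: M_def nakayama_matrix_def d_def)
  obtain n P Q where wit: "{M, D, P, Q} \<subseteq> carrier_mat n n" "P * Q = 1\<^sub>m n" "Q * P = 1\<^sub>m n" "M = P * D * Q"
    using similar_matD[OF D(2)] unfolding M_def by blast
  have n: "n = d" using wit(1) M_dim by auto
  have car: "D \<in> carrier_mat d d" "P \<in> carrier_mat d d" "Q \<in> carrier_mat d d" using wit(1) n by auto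
  have QM: "Q * M = D * Q"
  proof -
    have "Q * M = Q * (P * (D * Q))"
      using wit(4) car by (simp add: assoc_mult_mat[of _ d d _ d _ d])
    also have "\<dots> = (Q * P) * (D * Q)"
      using car by (intro assoc_mult_mat[symmetric, of _ d d _ d _ d]) auto
    also have "\<dots> = D * Q" using wit(3) car n by (simp add: left_mult_one_mat[of _ d d])
    finally show ?thesis .
  qed
  define r where "r i x = representation (set bs) x (bs ! i)" for i x
  have expand: "x = (\<Sum>i<d. r i x *s bs ! i)" for x
  proof -
    have "x = (\<Sum>b\<in>set bs. representation (set bs) x b *s b)"
      using bs by (simp add: sum_representation_eq)
    also have "\<dots> = (\<Sum>i<d. r i x *s bs ! i)"
      unfolding r_def d_def
      by (rule sum.reindex_bij_betw[symmetric, OF bij_betw_nth[OF bs(1) refl refl]])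
    finally show ?thesis .
  qed
  have expand_g: "g x = (\<Sum>i<d. to_ac (r i x) * g (bs ! i))"
    if g: "\<And>x y. g (x + y) = g x + g y" "\<And>t x. g (t *s x) = to_ac t * g x"
    for g :: "'a \<Rightarrow> 'k alg_closure" and x
  proof -
    have "g 0 = 0" using g(2)[of 0 0] by simp
    then have "g (\<Sum>i\<in>I. h i) = (\<Sum>i\<in>I. g (h i))" for I :: "nat set" and h
      by (induction I rule: infinite_finite_induct) (simp_all add: g(1))
    then show ?thesis by (subst expand) (simp add: g(2))
  qed
  define \<phi> where "\<phi> j x = (\<Sum>i<d. Q $$ (j, i) * to_ac (r i x))" for j x
  have r_lin: "r i (x + y) = r i x + r i y" "r i (t *s x) = t * r i x" for i x y t
    using bs by (simp_all add: r_def representation_add representation_scale)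
  have \<phi>_lin: "\<phi> j (x + y) = \<phi> j x + \<phi> j y" "\<phi> j (t *s x) = to_ac t * \<phi> j x" for j x y t
    by (simp_all add: \<phi>_def r_lin algebra_simps sum.distrib sum_distrib_left)
  have rN: "to_ac (r i (nakayama x)) = (\<Sum>l<d. M $$ (i, l) * to_ac (r l x))" if "i < d" for i x
  proof -
    have "to_ac (r i (nakayama x)) = (\<Sum>l<d. to_ac (r l x) * to_ac (r i (nakayama (bs ! l))))"
      by (rule expand_g) (simp_all add: nakayama_add nakayama_scale r_lin)
    also have "\<dots> = (\<Sum>l<d. M $$ (i, l) * to_ac (r l x))"
      using that by (intro sum.cong) (auto simp: M_def nakayama_matrix_def d_def r_def)
    finally show ?thesis .
  qed
  have eigen: "\<phi> j (nakayama x) = D $$ (j, j) * \<phi> j x" if j: "j < d" for j x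
  proof -
    have "\<phi> j (nakayama x) = (\<Sum>i<d. Q $$ (j, i) * (\<Sum>l<d. M $$ (i, l) * to_ac (r l x)))"
      by (simp add: \<phi>_def rN)
    also have "\<dots> = (\<Sum>l<d. (\<Sum>i<d. Q $$ (j, i) * M $$ (i, l)) * to_ac (r l x))"
      by (simp add: sum_distrib_left sum_distrib_right mult.assoc) (rule sum.swap)
    also have "\<dots> = (\<Sum>l<d. (Q * M) $$ (j, l) * to_ac (r l x))"
      using j car M_dim
      by (intro sum.cong) (auto simp: scalar_prod_def lessThan_atLeast0)
    also have "\<dots> = (\<Sum>l<d. D $$ (j, j) * Q $$ (j, l) * to_ac (r l x))"
    proof (intro sum.cong refl)
      fix l assume "l \<in> {..<d}"
      then have "(D * Q) $$ (j, l) = (\<Sum>i<d. D $$ (j, i) * Q $$ (i, l))"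
        using j car by (auto simp: scalar_prod_def lessThan_atLeast0)
      also have "\<dots> = (\<Sum>i<d. if i = j then D $$ (j, j) * Q $$ (j, l) else 0)"
        using D(1) car j by (intro sum.cong) (auto simp: diagonal_mat_def)
      also have "\<dots> = D $$ (j, j) * Q $$ (j, l)" using j by simp
      finally show "(Q * M) $$ (j, l) * to_ac (r l x) = D $$ (j, j) * Q $$ (j, l) * to_ac (r l x)"
        by (simp add: QM)
    qed
    also have "\<dots> = D $$ (j, j) * \<phi> j x"
      by (simp add: \<phi>_def sum_distrib_left mult.assoc)
    finally show ?thesis .
  qed
  have PQ: "to_ac (r i x) = (\<Sum>j<d. P $$ (i, j) * \<phi> j x)" if i: "i < d" for i x
  proof -
    have "(\<Sum>j<d. P $$ (i, j) * \<phi> j x) = (\<Sum>l<d. (\<Sum>j<d. P $$ (i, j) * Q $$ (j, l)) * to_ac (r l x))"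
      by (simp add: \<phi>_def sum_distrib_left sum_distrib_right mult.assoc) (rule sum.swap)
    also have "\<dots> = (\<Sum>l<d. (P * Q) $$ (i, l) * to_ac (r l x))"
      using i car by (intro sum.cong) (auto simp: scalar_prod_def lessThan_atLeast0)
    also have "\<dots> = (\<Sum>l<d. if l = i then to_ac (r l x) else 0)"
      using i n wit(2) by (intro sum.cong) auto
    also have "\<dots> = to_ac (r i x)" using i by simp
    finally show ?thesis ..
  qed
  have "g x = (\<Sum>j<d. \<phi> j x * (\<Sum>i<d. P $$ (i, j) * g (bs ! i)))"
    if g: "\<forall>x y. g (x + y) = g x + g y" "\<forall>t x. g (t *s x) = to_ac t * g x"
    for g :: "'a \<Rightarrow> 'k alg_closure" and x
  proof -
    have "g x = (\<Sum>i<d. (\<Sum>j<d. P $$ (i, j) * \<phi> j x) * g (bs ! i))"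
      by (subst expand_g) (use g in \<open>simp_all add: PQ\<close>)
    also have "\<dots> = (\<Sum>j<d. \<phi> j x * (\<Sum>i<d. P $$ (i, j) * g (bs ! i)))"
      by (simp add: sum_distrib_left sum_distrib_right mult_ac) (rule sum.swap)
    finally show ?thesis .
  qed
  then show ?thesis
    using eigen
    by (intro exI[of _ d] exI[of _ \<phi>] exI[of _ "\<lambda>j. D $$ (j, j)"] exI[of _ "\<lambda>i j. P $$ (i, j)"]
        exI[of _ "\<lambda>i. bs ! i"]) simp
qed

text \<open>
  Expanding \<open>F\<close> in its first letter into eigenfunctionals leaves multilinear functions of the other
  letters, with the weight \<open>z\<close> multiplied by an eigenvalue.  When no letter is left, the sum is the
  value of \<open>R\<close> at a product of eigenvalues.  The weight \<open>z\<close> is there to carry the induction; the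
  case of interest is \<open>z = 1\<close>.
\<close>

lemma polynomial_kills_multilin:
  fixes \<phi> :: "nat \<Rightarrow> 'a \<Rightarrow> 'k alg_closure"
  assumes eigen: "\<forall>j<d. \<forall>x. \<phi> j (nakayama x) = \<mu> j * \<phi> j x"
    and expand: "\<forall>g. (\<forall>x y. g (x + y) = g x + g y) \<longrightarrow> (\<forall>t x. g (t *s x) = to_ac t * g x) \<longrightarrow>
       (\<forall>x. g x = (\<Sum>j<d. \<phi> j x * (\<Sum>i<d. c i j * g (b i))))"
    and "degree R \<le> N"
    and "\<And>zs. length zs = n \<Longrightarrow> set zs \<subseteq> \<mu> ` {..<d} \<Longrightarrow> eval_ac R (z * prod_list zs) = 0"
    and "multilin scale to_ac n F" and "length ys = n"
  shows "(\<Sum>t\<le>N. to_ac (coeff R t) * z ^ t * F (map (nakayama ^^ t) ys)) = 0"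
  using assms(4-)
proof (induction n arbitrary: z F ys)
  case 0
  then have "eval_ac R z = 0" by simp
  moreover have "(\<Sum>t\<le>N. to_ac (coeff R t) * z ^ t * F (map (nakayama ^^ t) ys))
      = eval_ac R z * F []"
    using 0 by (simp only: eval_ac_altdef[OF assms(3)] sum_distrib_right) simp
  ultimately show ?case by simp
next
  case (Suc n)
  obtain x as where ys: "ys = x # as" and as: "length as = n"
    using Suc.prems(3) by (cases ys) auto
  define G where "G j as = (\<Sum>i<d. c i j * F (b i # as))" for j as
  have G: "multilin scale to_ac n (G j)" for j
    unfolding G_def
  proof (rule multilin_sum)
    fix i
    show "multilin scale to_ac n (\<lambda>as. F (b i # as))"
      by (rule multilin_comp_slotwise[OF Suc.prems(2) slotwise_Cons])
  qed
  have eigen_pow: "\<phi> j ((nakayama ^^ t) x) = \<mu> j ^ t * \<phi> j x" if "j < d" for j t x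
    by (induction t) (use eigen that in simp_all)
  have F: "F (x # as) = (\<Sum>j<d. \<phi> j x * G j as)" if "length as = n" for x as
  proof -
    have "F ((x + y) # as) = F (x # as) + F (y # as)" "F ((t *s x) # as) = to_ac t * F (x # as)" for x y t
      using Suc.prems(2) that unfolding multilin_def
      by (metis length_Cons list_update_code(2) zero_less_Suc)+
    then show ?thesis unfolding G_def using expand[rule_format, of "\<lambda>x. F (x # as)" x] by blast
  qed
  have zero: "(\<Sum>t\<le>N. to_ac (coeff R t) * (z * \<mu> j) ^ t * G j (map (nakayama ^^ t) as)) = 0"
    if j: "j < d" for j
  proof (rule Suc.IH[OF _ G as])
    fix zs assume "length zs = n" "set zs \<subseteq> \<mu> ` {..<d}"
    then show "eval_ac R (z * \<mu> j * prod_list zs) = 0"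
      using Suc.prems(1)[of "\<mu> j # zs"] j by (auto simp: mult.assoc)
  qed
  have "(\<Sum>t\<le>N. to_ac (coeff R t) * z ^ t * F (map (nakayama ^^ t) ys))
      = (\<Sum>t\<le>N. \<Sum>j<d. \<phi> j x * (to_ac (coeff R t) * (z * \<mu> j) ^ t * G j (map (nakayama ^^ t) as)))"
    using as by (auto simp: ys F eigen_pow sum_distrib_left power_mult_distrib mult_ac intro!: sum.cong)
  also have "\<dots> = (\<Sum>j<d. \<phi> j x * (\<Sum>t\<le>N. to_ac (coeff R t) * (z * \<mu> j) ^ t * G j (map (nakayama ^^ t) as)))"
    by (simp only: sum_distrib_left) (rule sum.swap)
  also have "\<dots> = 0" using zero by simp
  finally show ?case .
qed

text \<open>
  The operators \<open>r(T\<^sup>*)\<close> on cochains and \<open>r(T)\<close> on chains.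
\<close>

definition avg_cochain :: "'k poly \<Rightarrow> ('a list \<Rightarrow> 'a \<Rightarrow> 'k) \<Rightarrow> 'a list \<Rightarrow> 'a \<Rightarrow> 'k" where
  "avg_cochain r f = (\<lambda>as x. \<Sum>t\<le>degree r. coeff r t * (twist_cochain ^^ t) f as x)"

definition avg_chain :: "'k poly \<Rightarrow> ('a \<times> 'a list \<Rightarrow>\<^sub>0 'k) \<Rightarrow> ('a \<times> 'a list \<Rightarrow>\<^sub>0 'k)" where
  "avg_chain r p = (\<Sum>t\<le>degree r. fscale (coeff r t) ((twist_chain ^^ t) p))"

lemma twist_cochain_pow:
  "(twist_cochain ^^ t) f as x = f (map (nakayama ^^ t) as) ((nakayama ^^ t) x)"
proof (induction t arbitrary: as x)
  case (Suc t)
  have "(nakayama ^^ t) (nakayama y) = (nakayama ^^ Suc t) y" for y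
    by (simp add: funpow_swap1)
  then have "map (nakayama ^^ t) (map nakayama as) = map (nakayama ^^ Suc t) as"
    "(nakayama ^^ t) (nakayama x) = (nakayama ^^ Suc t) x" by (auto simp: o_def)
  moreover have "(twist_cochain ^^ Suc t) f as x = (twist_cochain ^^ t) f (map nakayama as) (nakayama x)"
    by (simp add: twist_cochain_def[of "(twist_cochain ^^ t) f"])
  ultimately show ?case by (simp only: Suc.IH)
qed simp

lemma twist_cochain_pow_cochain: "f \<in> cochains_Nd n \<Longrightarrow> (twist_cochain ^^ t) f \<in> cochains_Nd n"
  by (induction t) (auto intro: twist_cochain_cochain)

text \<open>
  Apply \<open>polynomial_kills_multilin\<close> to \<open>R = (X - 1) r\<close>, with \<open>r\<close> the separating polynomial of the set of
  products of \<open>n + 1\<close> eigenvalues: one for the coefficient and one for each of the \<open>n\<close> letters.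
\<close>

lemma invariant_average:
  assumes nakayama_semisimple
  obtains r :: "'k poly" where "poly r 1 = 1"
    "\<And>f. f \<in> cochains_Nd n \<Longrightarrow> twist_cochain (avg_cochain r f) = avg_cochain r f"
proof -
  obtain d :: nat and \<phi> \<mu> c b where
    eigen: "\<forall>j<d. \<forall>x. \<phi> j (nakayama x) = \<mu> j * \<phi> j x" and
    expand: "\<forall>g. (\<forall>x y. g (x + y) = g x + g y) \<longrightarrow> (\<forall>t x. g (t *s x) = to_ac t * g x) \<longrightarrow>
       (\<forall>x. g x = (\<Sum>j<d. \<phi> j x * (\<Sum>i<d. c i j * g (b i))))"
    using eigenfunctional_expansion[OF assms] by (elim exE conjE) (rule that)
  define S where "S = prod_list ` {zs. set zs \<subseteq> \<mu> ` {..<d} \<and> length zs = Suc n}"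
  have "finite S" unfolding S_def by (intro finite_imageI finite_lists_length_eq) auto
  then obtain r where r: "poly r 1 = 1" "\<And>z. z \<in> S \<Longrightarrow> z * eval_ac r z = eval_ac r z"
    using separating_polynomial by blast
  define R where "R = pCons 0 r - r"
  have R0: "eval_ac R z = 0" if "z \<in> S" for z
  proof -
    have "R + r = pCons 0 r" by (simp add: R_def)
    then have "eval_ac R z + eval_ac r z = z * eval_ac r z"
      by (metis eval_ac_add eval_ac_pCons add_0 to_ac_0)
    then show ?thesis using r(2)[OF that] by simp
  qed
  let ?N = "Suc (degree r)"
  have deg: "degree R \<le> ?N" unfolding R_def
    by (rule degree_diff_le) (auto simp: degree_pCons_le)
  have "twist_cochain (avg_cochain r f) = avg_cochain r f" if f: "f \<in> cochains_Nd n" for f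
  proof (intro ext)
    fix as x
    show "twist_cochain (avg_cochain r f) as x = avg_cochain r f as x"
    proof (cases "length as = n")
      case True
      define g where "g t = f (map (nakayama ^^ t) as) ((nakayama ^^ t) x)" for t
      have m: "multilin scale to_ac (Suc n) (\<lambda>ys. to_ac (uncurried f ys))"
        using f unfolding cochains_Nd_iff multilin_def by (metis to_ac_add to_ac_mult)
      have "(\<Sum>t\<le>?N. to_ac (coeff R t) * 1 ^ t * to_ac (uncurried f (map (nakayama ^^ t) (x # as)))) = 0"
        by (rule polynomial_kills_multilin[OF eigen expand deg _ m])
          (auto simp: True intro!: R0 simp: S_def)
      then have "to_ac (\<Sum>t\<le>?N. coeff R t * g t) = 0"
        by (simp add: to_ac_sum g_def del: sum.atMost_Suc)
      then have 0: "(\<Sum>t\<le>?N. coeff R t * g t) = 0" by (simp only: to_ac_eq_0_iff)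
      have "(\<Sum>t\<le>?N. coeff R t * g t) = (\<Sum>t\<le>?N. coeff (pCons 0 r) t * g t) - (\<Sum>t\<le>?N. coeff r t * g t)"
        by (simp only: R_def coeff_diff left_diff_distrib sum_subtractf)
      also have "(\<Sum>t\<le>?N. coeff (pCons 0 r) t * g t) = (\<Sum>t\<le>degree r. coeff r t * g (Suc t))"
        by (simp only: sum.atMost_Suc_shift coeff_pCons_Suc coeff_pCons_0 mult_zero_left add_0)
      also have "(\<Sum>t\<le>?N. coeff r t * g t) = (\<Sum>t\<le>degree r. coeff r t * g t)"
        by (simp add: coeff_eq_0)
      finally have "(\<Sum>t\<le>degree r. coeff r t * g (Suc t)) = (\<Sum>t\<le>degree r. coeff r t * g t)"
        using 0 by simp
      moreover have "twist_cochain (avg_cochain r f) as x = (\<Sum>t\<le>degree r. coeff r t * g (Suc t))"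
        by (simp add: twist_cochain_def avg_cochain_def twist_cochain_pow g_def o_def funpow_swap1)
      moreover have "avg_cochain r f as x = (\<Sum>t\<le>degree r. coeff r t * g t)"
        by (simp add: avg_cochain_def twist_cochain_pow g_def)
      ultimately show ?thesis by simp
    next
      case False
      then show ?thesis using cochain_length[OF f]
        by (simp add: twist_cochain_def avg_cochain_def twist_cochain_pow)
    qed
  qed
  then show ?thesis using that r(1) by blast
qed

lemma eval_avg_cochain:
  "eval_chain (avg_cochain r f) p = (\<Sum>t\<le>degree r. coeff r t * eval_chain ((twist_cochain ^^ t) f) p)"
  unfolding eval_chain_def avg_cochain_def sum_distrib_left
  by (subst sum.swap) (auto intro!: sum.cong simp: sum_distrib_left mult_ac)

lemma eval_avg: "eval_chain (avg_cochain r f) p = eval_chain f (avg_chain r p)"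
proof -
  have pow: "eval_chain ((twist_cochain ^^ t) f) p = eval_chain f ((twist_chain ^^ t) p)" for t
    by (induction t arbitrary: p) (simp_all add: eval_twist funpow_swap1[of twist_chain])
  have "eval_chain (avg_cochain r f) p = (\<Sum>t\<le>degree r. coeff r t * eval_chain ((twist_cochain ^^ t) f) p)"
    by (rule eval_avg_cochain)
  also have "\<dots> = (\<Sum>t\<le>degree r. coeff r t * eval_chain f ((twist_chain ^^ t) p))"
    by (simp only: pow)
  also have "\<dots> = eval_chain f (avg_chain r p)"
    by (simp add: eval_chain_eq_pairing avg_chain_def pairing_sum pairing_fscale)
  finally show ?thesis .
qed

section \<open>Linearity of the operations on chains and cochains\<close>

lemma eval_cochain_diff: "eval_chain (f - g) p = eval_chain f p - eval_chain g p"
  by (simp add: eval_chain_eq_pairing pairing_def case_prod_unfold algebra_simps sum_subtractf)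

lemma eval_cochain_zero [simp]: "eval_chain 0 p = 0"
  by (simp add: eval_chain_eq_pairing pairing_def case_prod_unfold)

lemma eval_add: "eval_chain f (p + q) = eval_chain f p + eval_chain f q"
  and eval_diff: "eval_chain f (p - q) = eval_chain f p - eval_chain f q"
  and eval_fscale: "eval_chain f (fscale c p) = c * eval_chain f p"
  and eval_gen [simp]: "eval_chain f (gen (x, as)) = f as x"
  by (simp_all add: eval_chain_eq_pairing pairing_add pairing_diff pairing_fscale)

lemma cochain_diff: "f \<in> cochains_Nd n \<Longrightarrow> g \<in> cochains_Nd n \<Longrightarrow> f - g \<in> cochains_Nd n"
  using multilin_diff[of scale "\<lambda>c. c" "Suc n" "uncurried f" "uncurried g"]
  by (auto simp: cochains_Nd_iff uncurried_def[abs_def])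

lemma cochain_zero: "0 \<in> cochains_Nd n"
  by (auto simp: cochains_def carrier_Nd_def scale_Nd_def)

lemma coboundary_diff: "coboundary_Nd n (f - g) = coboundary_Nd n f - coboundary_Nd n g"
  by (intro ext)
    (simp add: coboundary_map_def actl_Nd_def actr_Nd_def scale_Nd_def sum_fun_apply sum_subtractf sum_negf algebra_simps)

lemma coboundary_zero [simp]: "coboundary_Nd n 0 = 0"
  using coboundary_diff[of n 0 0] by simp

lemma Bbar_diff: "Bbar_cochain n (f - g) = Bbar_cochain n f - Bbar_cochain n g"
  by (intro ext) (simp add: Bbar_cochain_def sum_subtractf algebra_simps)

lemma Bbar_zero [simp]: "Bbar_cochain n 0 = 0"
  using Bbar_diff[of n 0 0] by simp

lemma boundary_add: "boundary_N n (p + q) = boundary_N n p + boundary_N n q"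
  and boundary_fscale: "boundary_N n (fscale c p) = fscale c (boundary_N n p)"
  by (simp_all add: boundary_map_def lin_ext_add lin_ext_fscale)

lemma boundary_diff: "boundary_N n (p - q) = boundary_N n p - boundary_N n q"
  using boundary_add[of n "p - q" q] by simp

lemma subspace_free_chains: "free.subspace (free_chains n)"
proof (rule free.subspaceI)
  show "0 \<in> free_chains n" by (simp add: free_chains_def)
  show "p + q \<in> free_chains n" if "p \<in> free_chains n" "q \<in> free_chains n" for p q
    using that keys_add[of p q] by (fastforce simp: free_chains_def)
  show "fscale c p \<in> free_chains n" if "p \<in> free_chains n" for c p
  proof -
    have "Poly_Mapping.keys (fscale c p) \<subseteq> Poly_Mapping.keys p" by (auto simp: in_keys_iff)
    then show ?thesis using that by (auto simp: free_chains_def)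
  qed
qed

lemma free_chains_keys:
  "p \<in> free_chains n \<Longrightarrow> y \<in> Poly_Mapping.keys p \<Longrightarrow> length (snd y) = n"
  by (auto simp: free_chains_def)

lemma gen_free_chain: "length as = n \<Longrightarrow> gen (x, as) \<in> free_chains n"
  by (simp add: free_chains_def)

lemma lin_ext_in_subspace:
  "free.subspace S \<Longrightarrow> (\<And>x. x \<in> Poly_Mapping.keys p \<Longrightarrow> g x \<in> S) \<Longrightarrow> lin_ext g p \<in> S"
  unfolding lin_ext_def by (intro free.subspace_sum free.subspace_scale)

lemma subspace_tensor_rel: "free.subspace (tensor_rel_N n)"
  unfolding tensor_rel_def by (rule free.subspace_span)

lemmas free_chains_closed =
  free.subspace_add[OF subspace_free_chains] free.subspace_diff[OF subspace_free_chains]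
  free.subspace_scale[OF subspace_free_chains] free.subspace_sum[OF subspace_free_chains]

lemma tensor_rel_free_chains: "tensor_rel_N n \<subseteq> free_chains n"
  unfolding tensor_rel_def
  by (rule free.span_minimal[OF _ subspace_free_chains])
    (auto intro!: free_chains_closed gen_free_chain)

lemma boundary_free_chains:
  fixes p :: "'a \<times> 'a list \<Rightarrow>\<^sub>0 'k"
  assumes p: "p \<in> free_chains (Suc n)"
  shows "boundary_N (Suc n) p \<in> free_chains n"
proof -
  have "(case y of (x, as) \<Rightarrow> gen (actr_N x (hd as), tl as)
       + (\<Sum>i<Suc n - 1. fscale ((-1) ^ Suc i) (gen (x, merge i as)))
       + fscale ((-1) ^ Suc n) (gen (actl_N (last as) x, butlast as)))
     \<in> (free_chains n :: ('a \<times> 'a list \<Rightarrow>\<^sub>0 'k) set)"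
    if "y \<in> Poly_Mapping.keys p" for y
    using free_chains_keys[OF p that] unfolding case_prod_unfold
    by (intro free_chains_closed gen_free_chain) auto
  then show ?thesis
    unfolding boundary_map_def by (auto intro!: lin_ext_in_subspace[OF subspace_free_chains])
qed

lemma twist_chain_free:
  assumes p: "p \<in> free_chains n"
  shows "twist_chain p \<in> free_chains n"
  unfolding twist_chain_def case_prod_unfold
  by (rule lin_ext_in_subspace[OF subspace_free_chains], rule gen_free_chain)
    (simp add: free_chains_keys[OF p])

lemma avg_chain_free:
  assumes "p \<in> free_chains n"
  shows "avg_chain r p \<in> free_chains n"
proof -
  have "(twist_chain ^^ t) p \<in> free_chains n" for t
    by (induction t) (auto intro: assms twist_chain_free)
  then show ?thesis by (auto simp: avg_chain_def intro!: free_chains_closed)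
qed

lemma B_chain_free:
  assumes "p \<in> free_chains n"
  shows "B_chain n p \<in> free_chains (Suc n)"
  unfolding B_chain_def case_prod_unfold
  by (rule lin_ext_in_subspace[OF subspace_free_chains], intro free_chains_closed gen_free_chain)
    (use free_chains_keys[OF assms] in \<open>auto simp: twisted_word_def\<close>)

section \<open>Duality between chains and cochains\<close>

text \<open>
  A functional on the free space that kills the multilinearity relations is a functional on the
  tensor product, that is, a cochain.
\<close>

lemma cochain_of_functional:
  assumes h: "\<And>p q. h (p + q) = h p + h q" "\<And>c p. h (fscale c p) = c * h p"
    and rel: "\<And>r. r \<in> tensor_rel_N n \<Longrightarrow> h r = (0 :: 'k)"
  obtains g where "g \<in> cochains_Nd n" "\<And>p. p \<in> free_chains n \<Longrightarrow> eval_chain g p = h p"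
proof
  define g where "g = (\<lambda>as x. if length as = n then h (gen (x, as)) else 0)"
  have hd: "h (p - q) = h p - h q" for p q using h(1)[of "p - q" q] by simp
  have add0: "h (gen (x + y, as)) = h (gen (x, as)) + h (gen (y, as))"
    and sc0: "h (gen (c *s x, as)) = c * h (gen (x, as))"
    if "length as = n" for x y c as
  proof -
    have "gen (x + y, as) - gen (x, as) - gen (y, as) \<in> tensor_rel_N n"
      unfolding tensor_rel_def using that by (intro free.span_base) blast
    from rel[OF this] show "h (gen (x + y, as)) = h (gen (x, as)) + h (gen (y, as))"
      by (simp add: hd h(1) diff_diff_eq)
    have "gen (c *s x, as) - fscale c (gen (x, as)) \<in> tensor_rel_N n"
      unfolding tensor_rel_def using that by (intro free.span_base) blast
    from rel[OF this] show "h (gen (c *s x, as)) = c * h (gen (x, as))"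
      by (simp add: hd h)
  qed
  have add: "h (gen (z, as[i := x + y])) = h (gen (z, as[i := x])) + h (gen (z, as[i := y]))"
    and sc: "h (gen (z, as[i := c *s x])) = c * h (gen (z, as[i := x]))"
    if "length as = n" "i < n" for x y c as i z
  proof -
    have "gen (z, as[i := x + y]) - gen (z, as[i := x]) - gen (z, as[i := y]) \<in> tensor_rel_N n"
      unfolding tensor_rel_def using that by (intro free.span_base) blast
    from rel[OF this] show "h (gen (z, as[i := x + y])) = h (gen (z, as[i := x])) + h (gen (z, as[i := y]))"
      by (simp add: hd h(1) diff_diff_eq)
    have "gen (z, as[i := c *s x]) - fscale c (gen (z, as[i := x])) \<in> tensor_rel_N n"
      unfolding tensor_rel_def using that by (intro free.span_base) blast
    from rel[OF this] show "h (gen (z, as[i := c *s x])) = c * h (gen (z, as[i := x]))"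
      by (simp add: hd h)
  qed
  show "g \<in> cochains_Nd n"
    by (auto simp: g_def cochains_def carrier_Nd_def scale_Nd_def add0 sc0 add sc fun_eq_iff)
  fix p :: "('a \<times> 'a list) \<Rightarrow>\<^sub>0 'k"
  assume "p \<in> free_chains n"
  then show "eval_chain g p = h p"
    by (subst linear_functional_eq_pairing[OF h])
      (auto simp: eval_chain_eq_pairing g_def free_chains_def intro!: pairing_cong)
qed

text \<open>
  Extend the functional \<open>t p \<mapsto> t\<close> from the line through \<open>p\<close>.
\<close>

lemma separating_functional:
  fixes p :: "'b \<Rightarrow>\<^sub>0 'k"
  assumes W: "free.subspace W" and p: "p \<notin> W"
  obtains h where "\<And>p q. h (p + q) = h p + h q" "\<And>c p. h (fscale c p) = c * h p"
    "\<And>w. w \<in> W \<Longrightarrow> h w = 0" "h p = (1 :: 'k)"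
proof -
  interpret K: vector_space "(*) :: 'k \<Rightarrow> 'k \<Rightarrow> 'k"
    by unfold_locales (auto simp: algebra_simps)
  have ker: "t = 0" if t: "fscale t p \<in> W" for t
  proof (rule ccontr)
    assume "t \<noteq> 0"
    then have "p = fscale (1 / t) (fscale t p)" by simp
    then show False using free.subspace_scale[OF W t, of "1 / t"] p by simp
  qed
  show ?thesis
  proof (rule functional_extension[of "(*)" fscale "\<lambda>t. fscale t p" "\<lambda>t. t" UNIV W])
    fix h assume h: "\<And>x y. h (x + y) = h x + h y" "\<And>c x. h (fscale c x) = c * h x"
      "\<And>w. w \<in> W \<Longrightarrow> h w = 0" "\<And>t. t \<in> UNIV \<Longrightarrow> h (fscale t p) = t"
    show thesis by (rule that[OF h(1-3)]) (use h(4)[of 1] in simp_all)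
  qed (use W ker in \<open>simp_all add: K.vector_space_axioms free.vector_space_axioms
        free.scale_left_distrib K.subspace_UNIV\<close>)
qed

lemma in_tensor_rel_if_all_cochains_vanish:
  assumes p: "p \<in> free_chains n" and 0: "\<And>f. f \<in> cochains_Nd n \<Longrightarrow> eval_chain f p = 0"
  shows "p \<in> tensor_rel_N n"
proof (rule ccontr)
  assume "p \<notin> tensor_rel_N n"
  then obtain h where h: "\<And>p q. h (p + q) = h p + h q" "\<And>c p. h (fscale c p) = c * h p"
    "\<And>w. w \<in> tensor_rel_N n \<Longrightarrow> h w = 0" "h p = (1 :: 'k)"
    using separating_functional[OF subspace_tensor_rel] by metis
  obtain g where "g \<in> cochains_Nd n" "eval_chain g p = h p"
    using cochain_of_functional[OF h(1-3)] p by metis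
  then show False using 0 h(4) by simp
qed

lemma subspace_boundaries: "free.subspace (boundaries_N n)"
proof -
  have "boundaries_N n = {x + y | x y. x \<in> boundary_N (Suc n) ` free_chains (Suc n) \<and> y \<in> tensor_rel_N n}"
    by (auto simp: boundaries_def)
  moreover have "free.subspace (boundary_N (Suc n) ` free_chains (Suc n))"
    unfolding free.subspace_def
  proof (intro conjI ballI allI)
    show "0 \<in> boundary_N (Suc n) ` free_chains (Suc n)"
      using free.subspace_0[OF subspace_free_chains] boundary_diff[of "Suc n" 0 0] by (metis diff_self imageI)
  qed (auto simp: boundary_add[symmetric] boundary_fscale[symmetric] intro!: imageI free_chains_closed)
  ultimately show ?thesis
    using free.subspace_sums[OF _ subspace_tensor_rel] by simp
qed

lemma subgroup_boundaries: "subgroup_add (boundaries_N n)"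
  using subspace_boundaries[of n] free.subspace_0 free.subspace_diff by (auto simp: subgroup_add_def)

lemma tensor_rel_boundaries: "tensor_rel_N n \<subseteq> boundaries_N n"
proof
  fix r assume r: "r \<in> tensor_rel_N n"
  have "r = boundary_N (Suc n) 0 + r" using boundary_diff[of "Suc n" 0 0] by simp
  then show "r \<in> boundaries_N n"
    using r free.subspace_0[OF subspace_free_chains, of "Suc n"]
    unfolding boundaries_def mem_Collect_eq by (intro exI[of _ 0] exI[of _ r]) simp
qed

lemma boundary_in_boundaries:
  assumes "p \<in> free_chains (Suc n)"
  shows "boundary_N (Suc n) p \<in> boundaries_N n"
proof -
  have "boundary_N (Suc n) p = boundary_N (Suc n) p + 0" by simp
  then show ?thesis
    using assms free.subspace_0[OF subspace_tensor_rel] unfolding boundaries_def by blast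
qed

lemma cocycle_cochain: "f \<in> cocycles_Nd n \<Longrightarrow> f \<in> cochains_Nd n"
  and cocycle_coboundary: "f \<in> cocycles_Nd n \<Longrightarrow> coboundary_Nd n f = 0"
  by (simp_all add: cocycles_def)

lemma cocycle_diff: "f \<in> cocycles_Nd n \<Longrightarrow> g \<in> cocycles_Nd n \<Longrightarrow> f - g \<in> cocycles_Nd n"
  by (simp add: cocycles_def cochain_diff coboundary_diff)

lemma coboundaries_Suc: "coboundaries_Nd (Suc m) = coboundary_Nd m ` cochains_Nd m"
  and coboundaries_0: "coboundaries_Nd 0 = {0}"
  by (simp_all add: coboundaries_def)

lemma subgroup_coboundaries: "subgroup_add (coboundaries_Nd n)"
proof (cases n)
  case 0
  then show ?thesis by (simp add: coboundaries_0 subgroup_add_def)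
next
  case (Suc m)
  show ?thesis
    unfolding Suc coboundaries_Suc subgroup_add_def
  proof (intro conjI ballI)
    show "0 \<in> coboundary_Nd m ` cochains_Nd m"
      using imageI[OF cochain_zero, of "coboundary_Nd m" m] by simp
    fix f g assume "f \<in> coboundary_Nd m ` cochains_Nd m" "g \<in> coboundary_Nd m ` cochains_Nd m"
    then show "f - g \<in> coboundary_Nd m ` cochains_Nd m"
      by (auto simp flip: coboundary_diff intro!: imageI cochain_diff)
  qed
qed

lemma coboundary_is_cocycle: "h \<in> coboundaries_Nd n \<Longrightarrow> h \<in> cocycles_Nd n"
  by (cases n) (auto simp: coboundaries_Suc coboundaries_0 cocycles_def cochain_zero
      coboundary_cochain coboundary_coboundary)

lemma cycle_free: "p \<in> cycles_N n \<Longrightarrow> p \<in> free_chains n"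
  by (simp add: cycles_def)

lemma eval_coboundary_cycle:
  assumes "h \<in> coboundaries_Nd n" "p \<in> cycles_N n"
  shows "eval_chain h p = 0"
proof (cases n)
  case 0
  then show ?thesis using assms(1) by (simp add: coboundaries_0)
next
  case (Suc m)
  then obtain g where g: "g \<in> cochains_Nd m" "h = coboundary_Nd m g"
    using assms(1) by (auto simp: coboundaries_Suc)
  then show ?thesis
    using assms(2) eval_coboundary eval_tensor_rel by (simp add: Suc cycles_def)
qed

lemma eval_cocycle_boundary:
  assumes f: "f \<in> cocycles_Nd n" and q: "q \<in> boundaries_N n"
  shows "eval_chain f q = 0"
proof -
  obtain p r where "q = boundary_N (Suc n) p + r" "p \<in> free_chains (Suc n)" "r \<in> tensor_rel_N n"
    using q unfolding boundaries_def by blast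
  then show ?thesis
    using cocycle_coboundary[OF f] eval_tensor_rel[OF cocycle_cochain[OF f]]
    by (simp add: eval_add flip: eval_coboundary)
qed

text \<open>
  A chain is a cycle if its boundary is killed by all cochains, which by duality means that the
  chain is killed by all coboundaries.
\<close>

lemma cycle_if_coboundaries_vanish:
  assumes p: "p \<in> free_chains n" and 0: "\<And>m g. n = Suc m \<Longrightarrow> g \<in> cochains_Nd m \<Longrightarrow> eval_chain (coboundary_Nd m g) p = 0"
  shows "p \<in> cycles_N n"
proof (cases n)
  case 0
  then show ?thesis
    using p free.subspace_0[OF subspace_tensor_rel] by (simp add: cycles_def boundary_map_def)
next
  case (Suc m)
  have "boundary_N n p \<in> tensor_rel_N m"
    unfolding Suc
    by (rule in_tensor_rel_if_all_cochains_vanish)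
      (use p 0 in \<open>auto simp: Suc boundary_free_chains simp flip: eval_coboundary\<close>)
  then show ?thesis using p Suc by (simp add: cycles_def)
qed

lemma boundaries_free_chains: "boundaries_N n \<subseteq> free_chains n"
  using tensor_rel_free_chains boundary_free_chains
  by (auto simp: boundaries_def intro!: free_chains_closed)

lemma boundary_is_cycle:
  assumes "q \<in> boundaries_N n"
  shows "q \<in> cycles_N n"
proof (rule cycle_if_coboundaries_vanish)
  show "q \<in> free_chains n" using assms boundaries_free_chains by blast
  fix m g assume "n = Suc m" "g \<in> cochains_Nd m"
  then have "coboundary_Nd m g \<in> cocycles_Nd n"
    by (auto intro: coboundary_is_cocycle simp: coboundaries_Suc)
  then show "eval_chain (coboundary_Nd m g) q = 0"
    using assms by (rule eval_cocycle_boundary)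
qed

text \<open>
  A functional that separates \<open>p\<close> from the boundaries is a cochain, and it is a cocycle because it
  vanishes on boundaries.
\<close>

lemma in_boundaries_if_all_cocycles_vanish:
  assumes p: "p \<in> free_chains n" and 0: "\<And>f. f \<in> cocycles_Nd n \<Longrightarrow> eval_chain f p = 0"
  shows "p \<in> boundaries_N n"
proof (rule ccontr)
  assume "p \<notin> boundaries_N n"
  then obtain h where h: "\<And>p q. h (p + q) = h p + h q" "\<And>c p. h (fscale c p) = c * h p"
    "\<And>w. w \<in> boundaries_N n \<Longrightarrow> h w = 0" "h p = (1 :: 'k)"
    using separating_functional[OF subspace_boundaries] by metis
  obtain g where g: "g \<in> cochains_Nd n" "\<And>p. p \<in> free_chains n \<Longrightarrow> eval_chain g p = h p"
    using cochain_of_functional[of h n] h tensor_rel_boundaries by (metis subsetD)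
  have "coboundary_Nd n g as x = 0" for as x
  proof (cases "length as = Suc n")
    case True
    then have "gen (x, as) \<in> (free_chains (Suc n) :: ('a \<times> 'a list \<Rightarrow>\<^sub>0 'k) set)" by (rule gen_free_chain)
    then have "eval_chain (coboundary_Nd n g) (gen (x, as)) = 0"
      by (simp only: eval_coboundary g(2) boundary_free_chains h(3) boundary_in_boundaries)
    then show ?thesis by simp
  qed (simp add: coboundary_length)
  then have "g \<in> cocycles_Nd n" using g(1) by (simp add: cocycles_def fun_eq_iff)
  then show False using 0 g(2)[OF p] h(4) by simp
qed

text \<open>
  Such an \<open>f\<close> factors through the boundary map on its image modulo the relations.  Any extension of
  the induced functional to all chains of degree one less is a cochain with coboundary \<open>f\<close>.
\<close>

lemma in_coboundaries_if_vanishes_on_cycles: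
  assumes f: "f \<in> cochains_Nd n" and 0: "\<And>p. p \<in> cycles_N n \<Longrightarrow> eval_chain f p = 0"
  shows "f \<in> coboundaries_Nd n"
proof (cases n)
  case n: 0
  have "f as x = 0" for as x
  proof (cases "length as = 0")
    case True
    have "gen (x, as) \<in> cycles_N n"
      by (rule cycle_if_coboundaries_vanish) (use True n in \<open>auto intro: gen_free_chain\<close>)
    from 0[OF this] show ?thesis by simp
  qed (use cochain_length[OF f] n in simp)
  then show ?thesis by (simp add: n coboundaries_0 fun_eq_iff)
next
  case (Suc m)
  obtain h where h: "\<And>p q. h (p + q) = h p + h q" "\<And>c p. h (fscale c p) = c * h p"
    "\<And>w. w \<in> tensor_rel_N m \<Longrightarrow> h w = 0"
    "\<And>p. p \<in> free_chains n \<Longrightarrow> h (boundary_N n p) = eval_chain f p"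
    by (rule functional_extension[of fscale fscale "boundary_N n" "eval_chain f" "free_chains n" "tensor_rel_N m"])
      (auto simp: free.vector_space_axioms boundary_add boundary_fscale eval_add eval_fscale
        subspace_free_chains subspace_tensor_rel Suc cycles_def intro!: 0)
  obtain g where g: "g \<in> cochains_Nd m" "\<And>p. p \<in> free_chains m \<Longrightarrow> eval_chain g p = h p"
    using cochain_of_functional[of h m] h(1-3) by metis
  have "f as x = coboundary_Nd m g as x" for as x
  proof (cases "length as = Suc m")
    case True
    then have gen: "gen (x, as) \<in> (free_chains (Suc m) :: ('a \<times> 'a list \<Rightarrow>\<^sub>0 'k) set)" by (rule gen_free_chain)
    have "eval_chain (coboundary_Nd m g) (gen (x, as)) = eval_chain f (gen (x, as))"
      using gen h(4)[of "gen (x, as)"] by (simp only: eval_coboundary g(2) boundary_free_chains Suc)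
    then show ?thesis by simp
  qed (use cochain_length[OF f] Suc in \<open>simp add: coboundary_length\<close>)
  then have "f = coboundary_Nd m g" by (intro ext)
  then show ?thesis using g(1) by (simp add: Suc coboundaries_Suc)
qed

section \<open>Invariant representatives\<close>

lemma invariant_cochain_iff: "invariant_cochain f \<longleftrightarrow> twist_cochain f = f"
  by (auto simp: invariant_cochain_def twist_cochain_def fun_eq_iff)

lemma invariant_chain_iff: "invariant_chain n p \<longleftrightarrow> twist_chain p - p \<in> tensor_rel_N n"
  by (simp add: invariant_chain_def twist_chain_def)

text \<open>
  By the homotopy, \<open>T\<^sup>* f - f\<close> is the coboundary of \<open>Bbar f\<close>, or zero in degree 0.
\<close>

lemma eval_twist_cocycle:
  assumes f: "f \<in> cocycles_Nd n" and p: "p \<in> cycles_N n"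
  shows "eval_chain (twist_cochain f) p = eval_chain f p"
proof -
  have "eval_chain (twist_cochain f - f) p = 0"
  proof (cases n)
    case 0
    then show ?thesis
      using Bbar_homotopy_0[of f] cocycle_cochain[OF f] cocycle_coboundary[OF f] by simp
  next
    case (Suc m)
    have "twist_cochain f - f = coboundary_Nd m (Bbar_cochain m f)"
      using Bbar_homotopy[of f m] cocycle_cochain[OF f] cocycle_coboundary[OF f] by (simp add: Suc)
    moreover have "coboundary_Nd m (Bbar_cochain m f) \<in> coboundaries_Nd n"
      using cocycle_cochain[OF f] Bbar_cochain_cochain by (simp add: Suc coboundaries_Suc)
    ultimately show ?thesis using eval_coboundary_cycle[OF _ p] by simp
  qed
  then show ?thesis by (simp add: eval_cochain_diff)
qed

lemma twist_zero [simp]: "twist_cochain 0 = 0"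
  by (auto simp: twist_cochain_def fun_eq_iff)

lemma twist_cocycle: "f \<in> cocycles_Nd n \<Longrightarrow> twist_cochain f \<in> cocycles_Nd n"
  by (simp add: cocycles_def twist_cochain_cochain twist_coboundary)

lemma eval_twist_pow_cocycle:
  assumes f: "f \<in> cocycles_Nd n" and p: "p \<in> cycles_N n"
  shows "eval_chain ((twist_cochain ^^ t) f) p = eval_chain f p"
proof -
  have c: "(twist_cochain ^^ t) f \<in> cocycles_Nd n" for t
    by (induction t) (auto intro: f twist_cocycle)
  show ?thesis by (induction t) (simp_all add: eval_twist_cocycle[OF c p])
qed

lemma eval_avg_cocycle:
  assumes "f \<in> cocycles_Nd n" "p \<in> cycles_N n" "poly r 1 = 1"
  shows "eval_chain (avg_cochain r f) p = eval_chain f p"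
proof -
  have "eval_chain (avg_cochain r f) p = (\<Sum>t\<le>degree r. coeff r t * eval_chain ((twist_cochain ^^ t) f) p)"
    by (rule eval_avg_cochain)
  also have "\<dots> = poly r 1 * eval_chain f p"
    by (simp add: eval_twist_pow_cocycle[OF assms(1,2)] poly_altdef sum_distrib_right)
  finally show ?thesis using assms(3) by simp
qed

lemma avg_cochain_cochain:
  assumes "f \<in> cochains_Nd n"
  shows "avg_cochain r f \<in> cochains_Nd n"
proof -
  have "multilin scale (\<lambda>c. c) (Suc n) (\<lambda>ys. \<Sum>t\<in>{..degree r}. coeff r t * uncurried ((twist_cochain ^^ t) f) ys)"
    using twist_cochain_pow_cochain[OF assms] by (intro multilin_sum) (simp add: cochains_Nd_iff)
  moreover have "uncurried (avg_cochain r f)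
      = (\<lambda>ys. \<Sum>t\<in>{..degree r}. coeff r t * uncurried ((twist_cochain ^^ t) f) ys)"
    by (simp add: uncurried_def[abs_def] avg_cochain_def)
  moreover have "avg_cochain r f as = 0" if "length as \<noteq> n" for as
    using cochain_length[OF twist_cochain_pow_cochain[OF assms] that] 
    by (simp add: avg_cochain_def fun_eq_iff)
  ultimately show ?thesis by (simp add: cochains_Nd_iff)
qed

lemma avg_coboundary: "coboundary_Nd n (avg_cochain r f) = avg_cochain r (coboundary_Nd n f)"
proof (intro ext)
  fix as x
  have pow: "coboundary_Nd n ((twist_cochain ^^ t) f) = (twist_cochain ^^ t) (coboundary_Nd n f)" for t
    by (induction t) (simp_all add: twist_coboundary)
  show "coboundary_Nd n (avg_cochain r f) as x = avg_cochain r (coboundary_Nd n f) as x"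
  proof (cases "length as = Suc n")
    case True
    let ?ys = "x # as"
    have "uncurried (coboundary_Nd n (avg_cochain r f)) ?ys
      = (\<Sum>d\<le>Suc n. (-1) ^ d * (\<Sum>t\<le>degree r. coeff r t * uncurried ((twist_cochain ^^ t) f) (face d ?ys)))"
      using True by (subst uncurried_coboundary) (simp_all add: uncurried_def avg_cochain_def)
    also have "\<dots> = (\<Sum>t\<le>degree r. coeff r t *
        (\<Sum>d\<le>Suc n. (-1) ^ d * uncurried ((twist_cochain ^^ t) f) (face d ?ys)))"
      by (simp only: sum_distrib_left mult.left_commute) (rule sum.swap)
    also have "\<dots> = (\<Sum>t\<le>degree r. coeff r t * uncurried (coboundary_Nd n ((twist_cochain ^^ t) f)) ?ys)"
      using True by (subst uncurried_coboundary) simp_all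
    finally show ?thesis by (simp add: pow avg_cochain_def)
  next
    case False
    have "(twist_cochain ^^ t) (coboundary_Nd n f) as x = 0" for t
      unfolding pow[symmetric] using False by (simp add: coboundary_length)
    then show ?thesis using False by (simp add: coboundary_length avg_cochain_def)
  qed
qed

lemma avg_twist: "avg_cochain r (twist_cochain f) = twist_cochain (avg_cochain r f)"
proof (intro ext)
  fix as x
  have "(twist_cochain ^^ t) (twist_cochain f) as x = (twist_cochain ^^ t) f (map nakayama as) (nakayama x)" for t
    by (simp add: funpow_swap1[symmetric] twist_cochain_def[of "(twist_cochain ^^ t) f"])
  then show "avg_cochain r (twist_cochain f) as x = twist_cochain (avg_cochain r f) as x"
    by (simp add: avg_cochain_def twist_cochain_def)
qed

text \<open>
  Take \<open>r(T\<^sup>*) f\<close>.  On cycles it has the value \<open>r(1) = 1\<close> times that of \<open>f\<close>, so the difference to \<open>f\<close>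
  vanishes on cycles.
\<close>

lemma invariant_cocycle_exists:
  assumes nakayama_semisimple and f: "f \<in> cocycles_Nd n"
  obtains f' where "f' \<in> cocycles_Nd n" "invariant_cochain f'" "f' - f \<in> coboundaries_Nd n"
proof -
  obtain r where r: "poly r 1 = 1"
    "\<And>f. f \<in> cochains_Nd n \<Longrightarrow> twist_cochain (avg_cochain r f) = avg_cochain r f"
    using invariant_average[OF assms(1)] by metis
  let ?f = "avg_cochain r f"
  have "(twist_cochain ^^ t) 0 = 0" for t
    by (induction t) (simp_all only: funpow.simps id_apply o_apply twist_zero)
  then have "avg_cochain r 0 as x = 0" for as x
    by (simp only: avg_cochain_def) simp
  then have zero: "avg_cochain r 0 = 0" by (intro ext) simp
  have c: "?f \<in> cocycles_Nd n"
    using f by (simp add: cocycles_def avg_cochain_cochain avg_coboundary zero)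
  have "?f - f \<in> coboundaries_Nd n"
    by (rule in_coboundaries_if_vanishes_on_cycles)
      (use c f r(1) in \<open>auto simp: eval_cochain_diff eval_avg_cocycle intro!: cocycle_cochain cocycle_diff\<close>)
  then show ?thesis using that c r(2) f cocycle_cochain by (simp add: invariant_cochain_iff)
qed

text \<open>
  Take \<open>r(T) p\<close>.  Its required properties are membership statements in subspaces that are
  annihilators of cochains, coboundaries or cocycles, so all of them are checked by evaluation and
  reduce to the properties of \<open>r(T\<^sup>*)\<close>.
\<close>

lemma invariant_cycle_exists:
  assumes nakayama_semisimple and p: "p \<in> cycles_N n"
  obtains p' where "p' \<in> cycles_N n" "invariant_chain n p'" "p' - p \<in> boundaries_N n"
proof -
  obtain r where r: "poly r 1 = 1"
    "\<And>f. f \<in> cochains_Nd n \<Longrightarrow> twist_cochain (avg_cochain r f) = avg_cochain r f"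
    using invariant_average[OF assms(1)] by metis
  let ?p = "avg_chain r p"
  have free: "?p \<in> free_chains n" using p by (intro avg_chain_free cycle_free)
  have "?p \<in> cycles_N n"
  proof (rule cycle_if_coboundaries_vanish[OF free])
    fix m g assume "n = Suc m" "g \<in> cochains_Nd m"
    then have "coboundary_Nd m (avg_cochain r g) \<in> coboundaries_Nd n"
      by (simp add: coboundaries_Suc avg_cochain_cochain)
    then show "eval_chain (coboundary_Nd m g) ?p = 0"
      using p by (simp add: eval_coboundary_cycle flip: eval_avg avg_coboundary)
  qed
  moreover have "?p - p \<in> boundaries_N n"
    by (rule in_boundaries_if_all_cocycles_vanish)
      (use free.subspace_diff[OF subspace_free_chains free cycle_free[OF p]] p r(1)
        in \<open>simp_all add: eval_diff eval_avg_cocycle flip: eval_avg\<close>)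
  moreover have "twist_chain ?p - ?p \<in> tensor_rel_N n"
    by (rule in_tensor_rel_if_all_cochains_vanish)
      (use free.subspace_diff[OF subspace_free_chains twist_chain_free[OF free] free] r(2)
        in \<open>simp_all add: eval_diff avg_twist flip: eval_avg eval_twist\<close>)
  ultimately show ?thesis using that by (simp add: invariant_chain_iff)
qed

section \<open>Operators on classes\<close>

lemma cocycle_in_class:
  assumes "f \<in> cocycles_Nd n" "f' \<in> cls (coboundaries_Nd n) f"
  shows "f' \<in> cocycles_Nd n"
proof -
  have "f' - f \<in> cocycles_Nd n" using assms(2) by (simp add: cls_def coboundary_is_cocycle)
  moreover have "0 - f \<in> cocycles_Nd n"
    by (rule cocycle_diff[OF _ assms(1)]) (simp add: cocycles_def cochain_zero)
  ultimately have "(f' - f) - (0 - f) \<in> cocycles_Nd n" by (rule cocycle_diff)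
  then show ?thesis by simp
qed

lemma cycle_in_class:
  assumes "p \<in> cycles_N n" "p' \<in> cls (boundaries_N n) p"
  shows "p' \<in> cycles_N n"
proof -
  have "p' - p \<in> cycles_N n" using assms(2) by (simp add: cls_def boundary_is_cycle)
  then have "boundary_N n p + boundary_N n (p' - p) \<in> tensor_rel_N (n - 1)"
    and "p + (p' - p) \<in> free_chains n"
    using assms(1) free.subspace_add[OF subspace_tensor_rel] free.subspace_add[OF subspace_free_chains]
    unfolding cycles_def by blast+
  then show ?thesis by (simp add: cycles_def flip: boundary_add)
qed

lemma Cbar_cls:
  assumes f: "f \<in> cocycles_Nd n" and p: "p \<in> cycles_N n"
  shows "Cbar n (cls (coboundaries_Nd n) f) (cls (boundaries_N n) p) = (-1) ^ n * eval_chain f p"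
proof -
  have *: "eval_chain f' p' = eval_chain f p"
    if "f' \<in> cls (coboundaries_Nd n) f" "p' \<in> cls (boundaries_N n) p" for f' p'
  proof -
    have "eval_chain f' (p' - p) = 0"
      using that cocycle_in_class[OF f] by (intro eval_cocycle_boundary) (auto simp: cls_def)
    moreover have "eval_chain (f' - f) p = 0"
      using that p by (intro eval_coboundary_cycle) (auto simp: cls_def)
    ultimately show ?thesis by (simp add: eval_diff eval_cochain_diff)
  qed
  have "{(-1) ^ n * eval_chain f' p' | f' p'.
      f' \<in> cls (coboundaries_Nd n) f \<and> p' \<in> cls (boundaries_N n) p} = {(-1) ^ n * eval_chain f p}"
    (is "?S = _")
  proof
    show "?S \<subseteq> {(-1) ^ n * eval_chain f p}"
    proof
      fix y assume "y \<in> ?S"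
      then obtain f' p' where "y = (-1) ^ n * eval_chain f' p'"
        "f' \<in> cls (coboundaries_Nd n) f" "p' \<in> cls (boundaries_N n) p" by blast
      then show "y \<in> {(-1) ^ n * eval_chain f p}" using *[of f' p'] by simp
    qed
    show "{(-1) ^ n * eval_chain f p} \<subseteq> ?S"
      using cls_self[OF subgroup_coboundaries, of f n] cls_self[OF subgroup_boundaries, of p n] by blast
  qed
  moreover have "cls (boundaries_N n) p \<in> H_N n" using p by (simp add: homology_def)
  ultimately show ?thesis by (simp add: Cbar_def)
qed

text \<open>
  For a cochain \<open>g\<close>, the value of \<open>\<delta> g\<close> at \<open>B p\<close> is that of \<open>Bbar (\<delta> g)\<close> at \<open>p\<close>.  By the homotopy this
  is the value of \<open>T\<^sup>* g - g\<close>, which is zero as \<open>p\<close> is invariant, minus that of the coboundary of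
  \<open>Bbar g\<close>, which is zero as \<open>p\<close> is a cycle.
\<close>

lemma B_chain_cycle:
  assumes p: "p \<in> cycles_N n" and inv: "invariant_chain n p"
  shows "B_chain n p \<in> cycles_N (Suc n)"
proof (rule cycle_if_coboundaries_vanish)
  show "B_chain n p \<in> free_chains (Suc n)" by (intro B_chain_free cycle_free p)
  fix m g assume "Suc n = Suc m" "g \<in> cochains_Nd m"
  then have m: "m = n" and g: "g \<in> cochains_Nd n" by simp_all
  have tw: "eval_chain (twist_cochain g - g) p = 0"
    using eval_tensor_rel[OF g] inv by (simp add: eval_cochain_diff eval_twist invariant_chain_iff flip: eval_diff)
  have "eval_chain (Bbar_cochain n (coboundary_Nd n g)) p = 0"
  proof (cases n)
    case 0
    then show ?thesis using tw Bbar_homotopy_0[of g] g by simp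
  next
    case (Suc k)
    have "Bbar_cochain n (coboundary_Nd n g) = (twist_cochain g - g) - coboundary_Nd k (Bbar_cochain k g)"
      using Bbar_homotopy[of g k] g by (simp add: Suc)
    moreover have "coboundary_Nd k (Bbar_cochain k g) \<in> coboundaries_Nd n"
      using g Bbar_cochain_cochain by (simp add: Suc coboundaries_Suc)
    ultimately show ?thesis using tw eval_coboundary_cycle[OF _ p] by (simp only: eval_cochain_diff) simp
  qed
  then show "eval_chain (coboundary_Nd m g) (B_chain n p) = 0"
    using p by (simp add: m cycle_free flip: eval_Bbar)
qed

lemma Bbar_cocycle:
  assumes f: "f \<in> cocycles_Nd (Suc n)" and inv: "invariant_cochain f"
  shows "Bbar_cochain n f \<in> cocycles_Nd n"
  using Bbar_homotopy[OF cocycle_cochain[OF f]] cocycle_coboundary[OF f] inv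
    Bbar_cochain_cochain[OF cocycle_cochain[OF f]]
  by (simp add: cocycles_def invariant_cochain_iff)

text \<open>
  For two invariant representatives \<open>p\<close> and \<open>p'\<close> of one class, every cocycle \<open>f\<close> has the same value at
  \<open>B p\<close> and \<open>B p'\<close>: as these are cycles, \<open>f\<close> may be replaced by an invariant cocycle \<open>f'\<close>, and then
  \<open>Bbar f'\<close> is a cocycle, which does not see the boundary \<open>p' - p\<close>.
\<close>

lemma B_N_cls:
  assumes ss: nakayama_semisimple and p: "p \<in> cycles_N n" "invariant_chain n p"
  shows "B_N n (cls (boundaries_N n) p) = cls (boundaries_N (Suc n)) (B_chain n p)"
  unfolding B_N_def
proof (rule the_elem_image_const)
  show "{p' \<in> cls (boundaries_N n) p. invariant_chain n p'} \<noteq> {}"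
    using cls_self[OF subgroup_boundaries, of p n] p by blast
  fix p' assume "p' \<in> {p' \<in> cls (boundaries_N n) p. invariant_chain n p'}"
  then have p': "p' - p \<in> boundaries_N n" "p' \<in> cycles_N n" "invariant_chain n p'"
    using cycle_in_class[OF p(1)] by (auto simp: cls_def)
  have "B_chain n p' - B_chain n p \<in> boundaries_N (Suc n)"
  proof (rule in_boundaries_if_all_cocycles_vanish)
    show "B_chain n p' - B_chain n p \<in> free_chains (Suc n)"
      using p p' by (intro free_chains_closed B_chain_free cycle_free)
    fix f assume "f \<in> cocycles_Nd (Suc n)"
    then obtain f' where f': "f' \<in> cocycles_Nd (Suc n)" "invariant_cochain f'"
      "f' - f \<in> coboundaries_Nd (Suc n)"
      using invariant_cocycle_exists[OF ss] by blast
    have "eval_chain (f' - f) (B_chain n q) = 0" if "q \<in> cycles_N n" "invariant_chain n q" for q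
      using eval_coboundary_cycle[OF f'(3) B_chain_cycle[OF that]] .
    then have "eval_chain f (B_chain n p' - B_chain n p) = eval_chain f' (B_chain n p') - eval_chain f' (B_chain n p)"
      using p p' by (simp add: eval_diff eval_cochain_diff)
    also have "\<dots> = eval_chain (Bbar_cochain n f') (p' - p)"
      using p p' by (simp add: eval_diff eval_Bbar cycle_free)
    also have "\<dots> = 0"
      using eval_cocycle_boundary[OF Bbar_cocycle[OF f'(1,2)] p'(1)] .
    finally show "eval_chain f (B_chain n p' - B_chain n p) = 0" .
  qed
  then show "cls (boundaries_N (Suc n)) (B_chain n p') = cls (boundaries_N (Suc n)) (B_chain n p)"
    by (simp add: cls_eq_iff subgroup_boundaries)
qed

text \<open>
  The argument of \<open>B_N_cls\<close> with chains and cochains exchanged: a cocycle is tested on invariant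
  representatives of cycles.
\<close>

lemma Bbar_cls:
  assumes ss: nakayama_semisimple and f: "f \<in> cocycles_Nd (Suc n)" "invariant_cochain f"
  shows "Bbar n (cls (coboundaries_Nd (Suc n)) f) = cls (coboundaries_Nd n) (Bbar_cochain n f)"
  unfolding Bbar_def
proof (rule the_elem_image_const)
  show "{f' \<in> cls (coboundaries_Nd (Suc n)) f. invariant_cochain f'} \<noteq> {}"
    using cls_self[OF subgroup_coboundaries, of f "Suc n"] f by blast
  fix f' assume "f' \<in> {f' \<in> cls (coboundaries_Nd (Suc n)) f. invariant_cochain f'}"
  then have f': "f' - f \<in> coboundaries_Nd (Suc n)" "f' \<in> cocycles_Nd (Suc n)" "invariant_cochain f'"
    using cocycle_in_class[OF f(1)] by (auto simp: cls_def)
  have c: "Bbar_cochain n f' - Bbar_cochain n f \<in> cocycles_Nd n"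
    by (intro cocycle_diff Bbar_cocycle f f')
  have "Bbar_cochain n f' - Bbar_cochain n f \<in> coboundaries_Nd n"
  proof (rule in_coboundaries_if_vanishes_on_cycles[OF cocycle_cochain[OF c]])
    fix p assume "p \<in> cycles_N n"
    then obtain p' where p': "p' \<in> cycles_N n" "invariant_chain n p'" "p' - p \<in> boundaries_N n"
      using invariant_cycle_exists[OF ss] by blast
    have "eval_chain (Bbar_cochain n f' - Bbar_cochain n f) p
        = eval_chain (Bbar_cochain n f' - Bbar_cochain n f) p'"
      using eval_cocycle_boundary[OF c p'(3)] by (simp add: eval_diff)
    also have "\<dots> = eval_chain (f' - f) (B_chain n p')"
      using p' by (simp add: eval_Bbar cycle_free flip: Bbar_diff)
    also have "\<dots> = 0"
      by (rule eval_coboundary_cycle[OF f'(1) B_chain_cycle[OF p'(1,2)]])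
    finally show "eval_chain (Bbar_cochain n f' - Bbar_cochain n f) p = 0" .
  qed
  then show "cls (coboundaries_Nd n) (Bbar_cochain n f') = cls (coboundaries_Nd n) (Bbar_cochain n f)"
    by (simp add: cls_eq_iff subgroup_coboundaries)
qed

section \<open>The isomorphism with the Hochschild cohomology of the algebra\<close>

abbreviation "cochains_A \<equiv> cochains scale UNIV scale"
abbreviation "coboundary_A \<equiv> coboundary_map scale (*) ((*) :: 'a \<Rightarrow> 'a \<Rightarrow> 'a)"
abbreviation "cocycles_A \<equiv> cocycles scale UNIV scale (*) ((*) :: 'a \<Rightarrow> 'a \<Rightarrow> 'a)"
abbreviation "coboundaries_A \<equiv> coboundaries scale UNIV scale (*) ((*) :: 'a \<Rightarrow> 'a \<Rightarrow> 'a)"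

definition Z_cochain :: "('a list \<Rightarrow> 'a) \<Rightarrow> 'a list \<Rightarrow> 'a \<Rightarrow> 'k" where
  "Z_cochain g = (\<lambda>as. Z_map (g as))"

lemma Z_map_carrier: "Z_map a \<in> carrier_Nd"
  by (simp add: Z_map_def carrier_Nd_def form_add_right form_scale_right)

lemma Z_map_add: "Z_map (a + b) = Z_map a + Z_map b"
  by (auto simp: Z_map_def form_add_left)

lemma Z_map_scale: "Z_map (c *s a) = scale_Nd c (Z_map a)"
  by (auto simp: Z_map_def form_scale_left scale_Nd_def)

lemma Z_map_zero [simp]: "Z_map 0 = 0"
  using Z_map_add[of 0 0] by simp

lemma Z_map_diff: "Z_map (a - b) = Z_map a - Z_map b"
  using Z_map_add[of "a - b" b] by (simp add: eq_diff_eq)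

lemma Z_map_sum: "Z_map (\<Sum>i\<in>I. h i) = (\<Sum>i\<in>I. Z_map (h i))"
  by (induction I rule: infinite_finite_induct) (simp_all add: Z_map_add)

text \<open>
  Moving \<open>a\<close> to the other side of the form produces the Nakayama automorphism, which is the twist in
  the left action on the dual bimodule.
\<close>

lemma Z_map_actl: "Z_map (a * u) = actl_Nd a (Z_map u)"
proof
  fix x
  have "form (a * u) x = form (u * x) (nakayama a)"
    using form_assoc[of a u x] form_nakayama[of a "u * x"] by simp
  then show "Z_map (a * u) x = actl_Nd a (Z_map u) x" by (simp add: Z_map_def actl_Nd_def form_assoc)
qed

lemma Z_map_actr: "Z_map (u * b) = actr_Nd (Z_map u) b"
  by (auto simp: Z_map_def actr_Nd_def form_assoc)

lemma Z_cochain_eq_iff: "Z_cochain g = Z_cochain g' \<longleftrightarrow> g = g'"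
  using Z_map_inj by (auto simp: Z_cochain_def fun_eq_iff)

lemma Z_cochain_diff: "Z_cochain (g - g') = Z_cochain g - Z_cochain g'"
  by (auto simp: Z_cochain_def Z_map_diff)

lemma Z_cochain_zero [simp]: "Z_cochain 0 = 0"
  by (auto simp: Z_cochain_def)

lemma Z_cochain_iff: "Z_cochain g \<in> cochains_Nd n \<longleftrightarrow> g \<in> cochains_A n"
proof -
  have "Z_map a = Z_map b \<longleftrightarrow> a = b" for a b using Z_map_inj by auto
  moreover have "Z_map a = 0 \<longleftrightarrow> a = 0" for a using Z_map_inj[of a 0] by auto
  ultimately show ?thesis
    by (simp add: cochains_def Z_cochain_def Z_map_carrier flip: Z_map_add Z_map_scale)
qed

lemma Z_cochain_coboundary: "Z_cochain (coboundary_A n g) = coboundary_Nd n (Z_cochain g)"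
  by (intro ext) (simp add: Z_cochain_def coboundary_map_def Z_map_add Z_map_sum Z_map_scale
      del: power_Suc flip: Z_map_actl Z_map_actr)

lemma Z_cochain_surj:
  assumes "f \<in> cochains_Nd n"
  obtains g where "g \<in> cochains_A n" "f = Z_cochain g"
proof -
  have "\<forall>as. \<exists>a. Z_map a = f as" using assms Z_map_surj by (simp add: cochains_def)
  then obtain g where "\<forall>as. Z_map (g as) = f as" by metis
  then have "f = Z_cochain g" by (auto simp: Z_cochain_def)
  then show ?thesis using that assms Z_cochain_iff by metis
qed

lemma Z_cocycle_iff: "Z_cochain g \<in> cocycles_Nd n \<longleftrightarrow> g \<in> cocycles_A n"
proof -
  have "coboundary_Nd n (Z_cochain g) = 0 \<longleftrightarrow> coboundary_A n g = 0"
    using Z_cochain_eq_iff[of "coboundary_A n g" 0] by (simp add: Z_cochain_coboundary)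
  then show ?thesis by (simp add: cocycles_def Z_cochain_iff)
qed

lemma Z_coboundary_iff: "Z_cochain g \<in> coboundaries_Nd n \<longleftrightarrow> g \<in> coboundaries_A n"
proof (cases n)
  case 0
  then show ?thesis using Z_cochain_eq_iff[of g 0] by (simp add: coboundaries_def)
next
  case (Suc m)
  have "Z_cochain g \<in> coboundary_Nd m ` cochains_Nd m \<longleftrightarrow> g \<in> coboundary_A m ` cochains_A m"
  proof
    assume "Z_cochain g \<in> coboundary_Nd m ` cochains_Nd m"
    then obtain f where "f \<in> cochains_Nd m" "Z_cochain g = coboundary_Nd m f" by blast
    then obtain h where "h \<in> cochains_A m" "Z_cochain g = coboundary_Nd m (Z_cochain h)"
      using Z_cochain_surj by metis
    then show "g \<in> coboundary_A m ` cochains_A m"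
      by (auto simp: Z_cochain_eq_iff simp flip: Z_cochain_coboundary)
  next
    assume "g \<in> coboundary_A m ` cochains_A m"
    then show "Z_cochain g \<in> coboundary_Nd m ` cochains_Nd m"
      by (auto simp: Z_cochain_coboundary Z_cochain_iff)
  qed
  then show ?thesis by (simp add: Suc coboundaries_def)
qed

lemma subgroup_coboundaries_A: "subgroup_add (coboundaries_A n)"
  using subgroup_coboundaries[of n]
  unfolding subgroup_add_def Z_coboundary_iff[symmetric] by (simp add: Z_cochain_diff Z_coboundary_iff[symmetric])

lemma Z_star_cls:
  "Z_star n (cls (coboundaries_A n) g) = cls (coboundaries_Nd n) (Z_cochain g)"
  unfolding Z_star_def Z_cochain_def[symmetric]
proof (rule the_elem_image_const)
  show "cls (coboundaries_A n) g \<noteq> {}" using cls_self[OF subgroup_coboundaries_A] by blast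
  fix g' assume "g' \<in> cls (coboundaries_A n) g"
  then have "g' - g \<in> coboundaries_A n" by (simp add: cls_def)
  then show "cls (coboundaries_Nd n) (Z_cochain g') = cls (coboundaries_Nd n) (Z_cochain g)"
    by (simp add: cls_eq_iff subgroup_coboundaries Z_coboundary_iff flip: Z_cochain_diff)
qed

lemma partial_inv_cls:
  assumes g: "g \<in> cocycles_A n" and p: "p \<in> cycles_N n"
  shows "partial_inv n (cls (coboundaries_A n) g) (cls (boundaries_N n) p)
    = (-1) ^ n * eval_chain (Z_cochain g) p"
proof -
  have f: "Z_cochain g \<in> cocycles_Nd n" using g by (simp add: Z_cocycle_iff)
  have *: "eval_chain (Z_cochain g') p' = eval_chain (Z_cochain g) p"
    if "g' \<in> cls (coboundaries_A n) g" "p' \<in> cls (boundaries_N n) p" for g' p'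
  proof -
    have g': "Z_cochain g' \<in> cls (coboundaries_Nd n) (Z_cochain g)"
      using that(1) by (simp add: cls_def Z_coboundary_iff flip: Z_cochain_diff)
    have "eval_chain (Z_cochain g') (p' - p) = 0"
      using that cocycle_in_class[OF f g'] by (intro eval_cocycle_boundary) (auto simp: cls_def)
    moreover have "eval_chain (Z_cochain g' - Z_cochain g) p = 0"
      using g' p by (intro eval_coboundary_cycle) (auto simp: cls_def)
    ultimately show ?thesis by (simp add: eval_diff eval_cochain_diff)
  qed
  have "{(-1) ^ n * eval_chain (Z_cochain g') p' | g' p'.
      g' \<in> cls (coboundaries_A n) g \<and> p' \<in> cls (boundaries_N n) p}
      = {(-1) ^ n * eval_chain (Z_cochain g) p}"
    (is "?S = _")
  proof
    show "?S \<subseteq> {(-1) ^ n * eval_chain (Z_cochain g) p}"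
    proof
      fix y assume "y \<in> ?S"
      then obtain g' p' where "y = (-1) ^ n * eval_chain (Z_cochain g') p'"
        "g' \<in> cls (coboundaries_A n) g" "p' \<in> cls (boundaries_N n) p" by blast
      then show "y \<in> {(-1) ^ n * eval_chain (Z_cochain g) p}" using *[of g' p'] by simp
    qed
    show "{(-1) ^ n * eval_chain (Z_cochain g) p} \<subseteq> ?S"
      using cls_self[OF subgroup_coboundaries_A, of g n] cls_self[OF subgroup_boundaries, of p n] by blast
  qed
  moreover have "cls (boundaries_N n) p \<in> H_N n" using p by (simp add: homology_def)
  ultimately show ?thesis by (simp add: partial_inv_def flip: Z_cochain_def)
qed

lemma inj_partial_inv: "inj_on (partial_inv n) (HH_A n)"
proof (rule inj_onI)
  fix \<alpha> \<beta> assume "\<alpha> \<in> HH_A n" "\<beta> \<in> HH_A n" and eq: "partial_inv n \<alpha> = partial_inv n \<beta>"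
  then obtain g h where g: "g \<in> cocycles_A n" "\<alpha> = cls (coboundaries_A n) g"
    and h: "h \<in> cocycles_A n" "\<beta> = cls (coboundaries_A n) h"
    by (auto simp: cohomology_def)
  have "Z_cochain (g - h) \<in> coboundaries_Nd n"
  proof (rule in_coboundaries_if_vanishes_on_cycles)
    show "Z_cochain (g - h) \<in> cochains_Nd n"
      using g h by (simp add: Z_cochain_diff cochain_diff cocycle_cochain Z_cocycle_iff)
    fix p assume p: "p \<in> cycles_N n"
    have "(-1) ^ n * eval_chain (Z_cochain g) p = (-1) ^ n * eval_chain (Z_cochain h) p"
      using eq g h p by (metis partial_inv_cls)
    then show "eval_chain (Z_cochain (g - h)) p = 0"
      by (simp add: Z_cochain_diff eval_cochain_diff)
  qed
  then show "\<alpha> = \<beta>"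
    by (simp add: g h cls_eq_iff subgroup_coboundaries_A Z_coboundary_iff)
qed

text \<open>
  Let \<open>Z g = Bbar f\<close>.  For an invariant cycle \<open>p\<close>, the functional that \<open>partial\<close> is applied to has at the
  class of \<open>p\<close> the value \<open>- (-1)\<^sup>n\<^sup>+\<^sup>1 f (B p) = (-1)\<^sup>n (Bbar f) p\<close>, and this is the value of
  \<open>partial_inv\<close> of the class of \<open>g\<close>.
\<close>

lemma BV_Delta_cls:
  assumes ss: nakayama_semisimple and f: "f \<in> cocycles_Nd (Suc n)" "invariant_cochain f"
  shows "BV_Delta n (cls (coboundaries_Nd (Suc n)) f) = cls (coboundaries_Nd n) (Bbar_cochain n f)"
proof -
  have c: "Bbar_cochain n f \<in> cocycles_Nd n" by (rule Bbar_cocycle[OF f])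
  obtain g where g': "Bbar_cochain n f = Z_cochain g"
    using Z_cochain_surj[OF cocycle_cochain[OF c]] by blast
  then have g: "g \<in> cocycles_A n" using c by (simp add: Z_cocycle_iff)
  have "B_N_dual n (Cbar (Suc n) (cls (coboundaries_Nd (Suc n)) f))
      = partial_inv n (cls (coboundaries_A n) g)"
  proof
    fix \<xi>
    show "B_N_dual n (Cbar (Suc n) (cls (coboundaries_Nd (Suc n)) f)) \<xi>
      = partial_inv n (cls (coboundaries_A n) g) \<xi>"
    proof (cases "\<xi> \<in> H_N n")
      case True
      then obtain p0 where p0: "p0 \<in> cycles_N n" "\<xi> = cls (boundaries_N n) p0"
        by (auto simp: homology_def)
      obtain p where p: "p \<in> cycles_N n" "invariant_chain n p" "p - p0 \<in> boundaries_N n"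
        using invariant_cycle_exists[OF ss p0(1)] by blast
      have \<xi>: "\<xi> = cls (boundaries_N n) p"
        using p(3) p0(2) cls_eq_iff[OF subgroup_boundaries, of n p p0] by simp
      have "B_N_dual n (Cbar (Suc n) (cls (coboundaries_Nd (Suc n)) f)) \<xi>
          = - ((-1) ^ Suc n * eval_chain f (B_chain n p))"
        using True B_N_cls[OF ss p(1,2)] Cbar_cls[OF f(1) B_chain_cycle[OF p(1,2)]]
        by (simp add: B_N_dual_def \<xi>)
      also have "\<dots> = (-1) ^ n * eval_chain (Z_cochain g) p"
        using p(1) by (simp add: cycle_free flip: g' eval_Bbar)
      finally show ?thesis using partial_inv_cls[OF g p(1)] by (simp add: \<xi>)
    qed (simp add: B_N_dual_def partial_inv_def)
  qed
  moreover have "cls (coboundaries_A n) g \<in> HH_A n" using g by (simp add: cohomology_def)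
  ultimately have "partial n (B_N_dual n (Cbar (Suc n) (cls (coboundaries_Nd (Suc n)) f)))
      = cls (coboundaries_A n) g"
    by (simp add: partial_def the_inv_into_f_f inj_partial_inv)
  then show ?thesis by (simp add: BV_Delta_def Z_star_cls g')
qed

text \<open>
  Every class contains an invariant cocycle, for which both operators have been computed.
\<close>

lemma BV_Delta_eq_Bbar:
  assumes ss: nakayama_semisimple and \<alpha>: "\<alpha> \<in> H_Nd (Suc n)"
  shows "BV_Delta n \<alpha> = Bbar n \<alpha>" "Bbar n \<alpha> \<in> H_Nd n"
proof -
  obtain f0 where f0: "f0 \<in> cocycles_Nd (Suc n)" "\<alpha> = cls (coboundaries_Nd (Suc n)) f0"
    using \<alpha> by (auto simp: cohomology_def)
  obtain f where f: "f \<in> cocycles_Nd (Suc n)" "invariant_cochain f"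
    "f - f0 \<in> coboundaries_Nd (Suc n)"
    using invariant_cocycle_exists[OF ss f0(1)] by blast
  have "\<alpha> = cls (coboundaries_Nd (Suc n)) f"
    using f(3) f0(2) cls_eq_iff[OF subgroup_coboundaries, of "Suc n" f f0] by simp
  then show "BV_Delta n \<alpha> = Bbar n \<alpha>" "Bbar n \<alpha> \<in> H_Nd n"
    using BV_Delta_cls[OF ss f(1,2)] Bbar_cls[OF ss f(1,2)] Bbar_cocycle[OF f(1,2)]
    by (simp_all add: cohomology_def)
qed

end

theorem corollary4p4:
  fixes scale :: "'k::field \<Rightarrow> 'a::{ring, monoid_mult} \<Rightarrow> 'a"
    and form :: "'a \<Rightarrow> 'a \<Rightarrow> 'k"
    and n :: nat
  assumes "frobenius_algebra scale form"
    and "frobenius_algebra.nakayama_semisimple scale form"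
  shows "(\<forall>\<alpha> \<in> frobenius_algebra.H_Nd scale form (Suc n).
            frobenius_algebra.BV_Delta scale form n \<alpha> = frobenius_algebra.Bbar scale form n \<alpha> \<and>
            frobenius_algebra.Bbar scale form n \<alpha> \<in> frobenius_algebra.H_Nd scale form n) \<and>
         (\<forall>f \<in> frobenius_algebra.cocycles_Nd scale form (Suc n).
            frobenius_algebra.invariant_cochain form f \<longrightarrow>
            frobenius_algebra.Bbar scale form n
              (cls (frobenius_algebra.coboundaries_Nd scale form (Suc n)) f) =
            cls (frobenius_algebra.coboundaries_Nd scale form n)
              (frobenius_algebra.Bbar_cochain form n f))"
  using frobenius_algebra.BV_Delta_eq_Bbar[OF assms] frobenius_algebra.Bbar_cls[OF assms]
  by blast

end
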